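(* Let $\mathcal{H}$ be a complex Hilbert space of finite dimension $d$, and let $\mathsf{B}=\{\mathsf{B}_y\}_{y\in\Omega_{\mathsf{B}}}$ be an observable on $\mathcal{H}$ such that $$\dim\mathsf{B} \geq (d-1)^2+1 ,$$ where $\dim\mathsf{B}$ denotes the dimension of the complex linear span of $\{\mathsf{B}_y : y\in\Omega_{\mathsf{B}}\}$ in the space of $d\times d$ complex matrices. Then for every observable $\mathsf{A}=\{\mathsf{A}_x\}_{x\in\Omega_{\mathsf{A}}}$ on $\mathcal{H}$: $\mathsf{A}$ can be measured without disturbing $\mathsf{B}$ if and only if $\mathsf{A}$ and $\mathsf{B}$ commute.
   Context: An observable on $\mathcal{H}$ is a finite or countably infinite family $\mathsf{A}=\{\mathsf{A}_x\}_{x\in\Omega_{\mathsf{A}}}$ of positive bounded operators on $\mathcal{H}$ with $\sum_x\mathsf{A}_x=\mathbb{1}$ (a discrete POVM). Observables $\mathsf{A},\mathsf{B}$ commute if $\mathsf{A}_x\mathsf{B}_y=\mathsf{B}_y\mathsf{A}_x$ for all $x\in\Omega_{\mathsf{A}},y\in\Omega_{\mathsf{B}}$. An instrument implementing $\mathsf{A}$ is a family $\mathcal{I}=\{\mathcal{I}_x\}_{x\in\Omega_{\mathsf{A}}}$ of completely positive linear maps on the trace class operators on $\mathcal{H}$ such that $\mathcal{I}_x^*(\mathbb{1})=\mathsf{A}_x$ for all $x$; here the adjoint $\mathcal{I}_x^*$, acting on bounded operators, is defined by $\mathrm{tr}[X\,\mathcal{I}_x(Y)]=\mathrm{tr}[\mathcal{I}_x^*(X)Y]$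 for all bounded $X$ and trace class $Y$. Put $\mathcal{I}_\Omega:=\sum_x\mathcal{I}_x$ (a quantum channel), with adjoint $\mathcal{I}_\Omega^*$. $\mathsf{A}$ can be measured without disturbing $\mathsf{B}$ if there is an instrument $\mathcal{I}$ implementing $\mathsf{A}$ with $\mathcal{I}_\Omega^*(\mathsf{B}_y)=\mathsf{B}_y$ for all $y\in\Omega_{\mathsf{B}}$. *)

theory Defs
  imports "HOL-Analysis.Analysis"
begin

text \<open>The Hilbert space is \<open>complex ^ 'n\<close>, of dimension \<open>d = CARD('n)\<close>; its operators (all of
  them bounded and trace class) are the matrices \<open>complex ^ 'n ^ 'n\<close>.\<close>

type_synonym 'n cmat = "complex ^ 'n ^ 'n"

definition cscale :: "complex \<Rightarrow> 'n::finite cmat \<Rightarrow> 'n cmat" where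
  "cscale c M = (\<chi> i j. c * M $ i $ j)"

text \<open>Complex span, dimension and linearity; the unqualified \<open>span\<close>, \<open>dim\<close> and \<open>linear\<close> are the
  notions over the reals.\<close>

interpretation cmat: vector_space "cscale :: complex \<Rightarrow> 'n::finite cmat \<Rightarrow> 'n cmat"
  by unfold_locales (simp_all add: cscale_def vec_eq_iff algebra_simps)

abbreviation clinear_map :: "('n::finite cmat \<Rightarrow> 'n cmat) \<Rightarrow> bool" where
  "clinear_map \<equiv> Vector_Spaces.linear cscale cscale"

definition cinner :: "complex ^ 'n::finite \<Rightarrow> complex ^ 'n \<Rightarrow> complex" where
  "cinner v w = (\<Sum>i\<in>UNIV. cnj (v $ i) * w $ i)"

definition positive_op :: "'n::finite cmat \<Rightarrow> bool" where
  "positive_op M \<longleftrightarrow> (\<forall>v. cinner v (M *v v) \<in> \<real>\<^sub>\<ge>\<^sub>0)"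

definition observable :: "'x set \<Rightarrow> ('x \<Rightarrow> 'n::finite cmat) \<Rightarrow> bool" where
  "observable \<Omega> A \<longleftrightarrow>
     countable \<Omega> \<and> (\<forall>x\<in>\<Omega>. positive_op (A x)) \<and> (A has_sum mat 1) \<Omega>"

definition commuting :: "'x set \<Rightarrow> ('x \<Rightarrow> 'n::finite cmat) \<Rightarrow> 'y set \<Rightarrow> ('y \<Rightarrow> 'n cmat) \<Rightarrow> bool" where
  "commuting \<Omega>A A \<Omega>B B \<longleftrightarrow> (\<forall>x\<in>\<Omega>A. \<forall>y\<in>\<Omega>B. A x ** B y = B y ** A x)"

definition obs_dim :: "'y set \<Rightarrow> ('y \<Rightarrow> 'n::finite cmat) \<Rightarrow> nat" where
  "obs_dim \<Omega> B = cmat.dim (cmat.span (B ` \<Omega>))"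

text \<open>A \<open>k \<times> k\<close> block matrix \<open>(X i j)\<close> (indices \<open>i, j < k\<close>) with operator entries represents an
  operator on the \<open>k\<close>-fold direct sum of the Hilbert space, that is, on its tensor product with the
  \<open>k\<close>-dimensional space. Applying a map to every block is its \<open>k\<close>-th ampliation.\<close>

definition positive_block :: "nat \<Rightarrow> (nat \<Rightarrow> nat \<Rightarrow> 'n::finite cmat) \<Rightarrow> bool" where
  "positive_block k X \<longleftrightarrow>
     (\<forall>v :: nat \<Rightarrow> complex ^ 'n. (\<Sum>i<k. \<Sum>j<k. cinner (v i) (X i j *v v j)) \<in> \<real>\<^sub>\<ge>\<^sub>0)"

definition completely_positive :: "('n::finite cmat \<Rightarrow> 'n cmat) \<Rightarrow> bool" where
  "completely_positive \<Phi> \<longleftrightarrow>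
     clinear_map \<Phi> \<and> (\<forall>k X. positive_block k X \<longrightarrow> positive_block k (\<lambda>i j. \<Phi> (X i j)))"

text \<open>The trace-dual map; \<open>dual_map_trace\<close> and \<open>dual_map_unique\<close> below show that the description is
  proper for every complex linear map.\<close>

definition dual_map :: "('n::finite cmat \<Rightarrow> 'n cmat) \<Rightarrow> 'n cmat \<Rightarrow> 'n cmat" where
  "dual_map \<Phi> = (THE \<Psi>. \<forall>X Y. trace (X ** \<Phi> Y) = trace (\<Psi> X ** Y))"

definition instrument :: "'x set \<Rightarrow> ('x \<Rightarrow> 'n::finite cmat) \<Rightarrow> ('x \<Rightarrow> 'n cmat \<Rightarrow> 'n cmat) \<Rightarrow> bool" where
  "instrument \<Omega> A \<I> \<longleftrightarrow>
     (\<forall>x\<in>\<Omega>. completely_positive (\<I> x) \<and> dual_map (\<I> x) (mat 1) = A x)"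

text \<open>\<open>T\<close> is the total channel of the family \<open>\<I>\<close>. For an instrument of an observable the sum
  always converges, so requiring it below excludes no instrument: for positive \<open>Y\<close> the operators
  \<open>\<I> x Y\<close> are positive with summable traces \<open>trace (A x ** Y)\<close>, and every \<open>Y\<close> is a complex
  linear combination of positive ones.\<close>

definition total_channel :: "'x set \<Rightarrow> ('x \<Rightarrow> 'n::finite cmat \<Rightarrow> 'n cmat) \<Rightarrow> ('n cmat \<Rightarrow> 'n cmat) \<Rightarrow> bool" where
  "total_channel \<Omega> \<I> T \<longleftrightarrow> (\<forall>Y. ((\<lambda>x. \<I> x Y) has_sum T Y) \<Omega>)"

definition measurable_without_disturbing ::
    "'x set \<Rightarrow> ('x \<Rightarrow> 'n::finite cmat) \<Rightarrow> 'y set \<Rightarrow> ('y \<Rightarrow> 'n cmat) \<Rightarrow> bool" where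
  "measurable_without_disturbing \<Omega>A A \<Omega>B B \<longleftrightarrow>
     (\<exists>\<I> T. instrument \<Omega>A A \<I> \<and> total_channel \<Omega>A \<I> T \<and> (\<forall>y\<in>\<Omega>B. dual_map T (B y) = B y))"

definition matrix_unit :: "'n::finite \<Rightarrow> 'n \<Rightarrow> 'n cmat" where
  "matrix_unit k l = (\<chi> i j. if i = k \<and> j = l then 1 else 0)"

lemma trace_mult_matrix_unit: "trace (M ** matrix_unit k l) = M $ l $ k"
proof -
  have "(M ** matrix_unit k l) $ i $ i = (if i = l then M $ i $ k else 0)" for i
    by (simp add: matrix_matrix_mult_def matrix_unit_def if_distrib[of "\<lambda>x. _ * x"] cong: if_cong)
  then show ?thesis
    by (simp add: trace_def)
qed

lemma matrix_eq_if_trace_eq: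
  fixes M N :: "'n::finite cmat"
  assumes "\<And>Y. trace (M ** Y) = trace (N ** Y)"
  shows "M = N"
  using assms[of "matrix_unit _ _"] by (simp add: trace_mult_matrix_unit vec_eq_iff)

lemma matrix_unit_expansion: "Y = (\<Sum>k\<in>UNIV. \<Sum>l\<in>UNIV. cscale (Y $ k $ l) (matrix_unit k l))"
proof -
  have "(\<Sum>k\<in>UNIV. \<Sum>l\<in>UNIV. cscale (Y $ k $ l) (matrix_unit k l)) $ i $ j = Y $ i $ j" for i j
  proof -
    have "(\<Sum>l\<in>UNIV. cscale (Y $ k $ l) (matrix_unit k l) $ i $ j) = (if k = i then Y $ i $ j else 0)" for k
      by (simp add: cscale_def matrix_unit_def if_distrib[of "\<lambda>x. _ * x"] cong: if_cong)
    then show ?thesis by (simp add: sum_component)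
  qed
  then show ?thesis by (simp add: vec_eq_iff)
qed

lemma dual_map_exists:
  fixes \<Phi> :: "'n::finite cmat \<Rightarrow> 'n cmat"
  assumes "clinear_map \<Phi>"
  shows "\<exists>\<Psi>. \<forall>X Y. trace (X ** \<Phi> Y) = trace (\<Psi> X ** Y)"
proof -
  interpret \<Phi>: Vector_Spaces.linear cscale cscale \<Phi> by fact
  have tr_sum: "trace (X ** (\<Sum>k\<in>UNIV. \<Sum>l\<in>UNIV. cscale (c k l) (M k l)))
      = (\<Sum>k\<in>UNIV. \<Sum>l\<in>UNIV. c k l * trace (X ** M k l))"
    for X :: "'n cmat" and c :: "'n \<Rightarrow> 'n \<Rightarrow> complex" and M
  proof -
    let ?t = "\<lambda>Z. trace (X ** Z)"
    have add: "?t (Y + Z) = ?t Y + ?t Z" for Y Z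
      by (simp add: matrix_add_ldistrib trace_add)
    have scale: "?t (cscale a Y) = a * ?t Y" for a Y
      by (simp add: trace_def matrix_matrix_mult_def cscale_def sum_distrib_left mult_ac)
    have zero: "trace (0 :: 'n cmat) = 0"
      by (simp add: trace_def)
    have sums: "?t (sum f S) = (\<Sum>s\<in>S. ?t (f s))" for f and S :: "'n set"
      by (induction S rule: infinite_finite_induct) (simp_all add: add zero)
    show ?thesis by (simp add: sums scale)
  qed
  have "trace (X ** \<Phi> Y) = trace ((\<chi> i j. trace (X ** \<Phi> (matrix_unit j i))) ** Y)" for X Y
  proof -
    have "\<Phi> Y = (\<Sum>k\<in>UNIV. \<Sum>l\<in>UNIV. cscale (Y $ k $ l) (\<Phi> (matrix_unit k l)))"
      by (subst matrix_unit_expansion[of Y]) (simp only: \<Phi>.sum \<Phi>.scale)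
    then have "trace (X ** \<Phi> Y) = (\<Sum>k\<in>UNIV. \<Sum>l\<in>UNIV. Y $ k $ l * trace (X ** \<Phi> (matrix_unit k l)))"
      by (simp only: tr_sum)
    also have "\<dots> = (\<Sum>l\<in>UNIV. \<Sum>k\<in>UNIV. Y $ k $ l * trace (X ** \<Phi> (matrix_unit k l)))"
      by (rule sum.swap)
    also have "\<dots> = trace ((\<chi> i j. trace (X ** \<Phi> (matrix_unit j i))) ** Y)"
      unfolding trace_def[of "_ ** Y"] by (simp add: matrix_matrix_mult_def[of _ Y] mult.commute)
    finally show ?thesis .
  qed
  then show ?thesis
    by (intro exI[of _ "\<lambda>X. \<chi> i j. trace (X ** \<Phi> (matrix_unit j i))"]) blast
qed

lemma dual_map_unique:
  assumes "\<And>X Y. trace (X ** \<Phi> Y) = trace (\<Psi> X ** Y)"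
  shows "dual_map \<Phi> = \<Psi>"
  unfolding dual_map_def
proof (rule the_equality)
  fix \<Theta> assume "\<forall>X Y. trace (X ** \<Phi> Y) = trace (\<Theta> X ** Y)"
  then show "\<Theta> = \<Psi>"
    using assms by (intro ext matrix_eq_if_trace_eq) metis
qed (use assms in blast)

lemma dual_map_trace:
  assumes "clinear_map \<Phi>"
  shows "trace (X ** \<Phi> Y) = trace (dual_map \<Phi> X ** Y)"
  using dual_map_exists[OF assms] dual_map_unique by metis

end

theory Submission
  imports Defs
begin

text \<open>If the observables commute, the Lueders instrument \<open>Y \<mapsto> A\<^sub>x\<^bsup>1/2\<^esup> Y A\<^sub>x\<^bsup>1/2\<^esup>\<close> does
  not disturb \<open>B\<close>. Conversely, let \<open>T\<close> be the total channel of a non-disturbing instrument and \<open>\<rho>\<close> a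
  limit point of the Cesaro means of \<open>T\<^sup>k(1)\<close>. If \<open>\<rho>\<close> had a null vector \<open>v\<close>, then limit points of the
  Cesaro means of any positive \<open>Y \<le> c 1\<close> would also kill \<open>v\<close>, so a fixed point of the dual map would
  be determined by its compression to a complement of \<open>v\<close>, which leaves at most \<open>(d - 1)\<^sup>2\<close>
  dimensions. Hence \<open>\<rho>\<close> is definite. For a fixed point \<open>b\<close> the defect \<open>T\<^sup>*(b\<^sup>2) - b\<^sup>2\<close> is positive and has
  expectation zero in \<open>\<rho>\<close>, so it vanishes. This is equality in the Schwarz inequality, which passes to
  each \<open>\<I>\<^sub>x\<close> and yields \<open>A\<^sub>x b = \<I>\<^sub>x\<^sup>*(b) = b A\<^sub>x\<close>.\<close>

section \<open>Matrices and positive operators\<close>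

definition cadj :: "'n::finite cmat \<Rightarrow> 'n cmat" where
  "cadj M = (\<chi> i j. cnj (M $ j $ i))"

text \<open>The rank-one operator |v><w|. Through \<open>trace_mult_ketbra\<close>, testing a trace
  identity on these operators turns it into a statement about quadratic forms.\<close>

definition ketbra :: "complex ^ 'n::finite \<Rightarrow> complex ^ 'n \<Rightarrow> 'n cmat" where
  "ketbra v w = (\<chi> i j. v $ i * cnj (w $ j))"

lemma cinner_add_left: "cinner (u + v) w = cinner u w + cinner v w"
  and cinner_add_right: "cinner u (v + w) = cinner u v + cinner u w"
  and cinner_diff_left: "cinner (u - v) w = cinner u w - cinner v w"
  and cinner_diff_right: "cinner u (v - w) = cinner u v - cinner u w"
  and cinner_minus_left: "cinner (- u) w = - cinner u w"
  and cinner_minus_right: "cinner u (- w) = - cinner u w"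
  and cinner_scale_left: "cinner (c *s u) w = cnj c * cinner u w"
  and cinner_scale_right: "cinner u (c *s w) = c * cinner u w"
  and cinner_scaleR_left: "cinner (r *\<^sub>R u) w = of_real r * cinner u w"
  and cinner_scaleR_right: "cinner u (r *\<^sub>R w) = of_real r * cinner u w"
  and cinner_zero_left: "cinner 0 w = 0"
  and cinner_zero_right: "cinner u 0 = 0"
  by (simp_all add: cinner_def algebra_simps sum.distrib sum_subtractf sum_negf sum_distrib_left
      scaleR_conv_of_real[where 'a=complex])

lemmas cinner_linear = cinner_add_left cinner_add_right cinner_diff_left cinner_diff_right
  cinner_minus_left cinner_minus_right cinner_scale_left cinner_scale_right
  cinner_scaleR_left cinner_scaleR_right cinner_zero_left cinner_zero_right

lemma cnj_cinner: "cnj (cinner v w) = cinner w v"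
  by (simp add: cinner_def mult.commute)

lemma cinner_self: "cinner v v = complex_of_real ((norm v)\<^sup>2)"
proof -
  have "cinner v v = (\<Sum>i\<in>UNIV. complex_of_real ((cmod (v $ i))\<^sup>2))"
    unfolding cinner_def
    by (intro sum.cong refl) (metis complex_norm_square mult.commute of_real_power)
  also have "\<dots> = complex_of_real ((norm v)\<^sup>2)"
    by (simp add: norm_vec_def L2_set_def sum_nonneg)
  finally show ?thesis .
qed

lemma cinner_axis: "cinner (axis i 1) v = v $ i"
  by (simp add: cinner_def axis_def if_distrib[of cnj] if_distrib[of "\<lambda>x. x * _"] cong: if_cong)

lemma matrix_entry_eq_cinner: "M $ i $ j = cinner (axis i 1) (M *v axis j 1)"
  by (simp add: cinner_axis)
    (simp add: matrix_vector_mult_def axis_def if_distrib[of "\<lambda>x. _ * x"] cong: if_cong)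

lemma cinner_adjoint: "cinner v (M *v w) = cinner (cadj M *v v) w"
proof -
  have "cinner v (M *v w) = (\<Sum>i\<in>UNIV. \<Sum>j\<in>UNIV. cnj (v $ i) * M $ i $ j * w $ j)"
    by (simp add: cinner_def matrix_vector_mult_def sum_distrib_left mult.assoc)
  also have "\<dots> = (\<Sum>j\<in>UNIV. \<Sum>i\<in>UNIV. cnj (v $ i) * M $ i $ j * w $ j)"
    by (rule sum.swap)
  also have "\<dots> = cinner (cadj M *v v) w"
    by (simp add: cinner_def cadj_def matrix_vector_mult_def sum_distrib_right sum_distrib_left mult_ac)
  finally show ?thesis .
qed

lemma cadj_cadj [simp]: "cadj (cadj M) = M"
  by (simp add: cadj_def vec_eq_iff)

lemma cadj_mult: "cadj (M ** N) = cadj N ** cadj M"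
  by (simp add: cadj_def matrix_matrix_mult_def vec_eq_iff mult.commute)

lemma cadj_add: "cadj (M + N) = cadj M + cadj N"
  and cadj_diff: "cadj (M - N) = cadj M - cadj N"
  and cadj_scaleR: "cadj (r *\<^sub>R M) = r *\<^sub>R cadj M"
  and cadj_mat_1: "cadj (mat 1) = mat 1"
  and cadj_zero: "cadj 0 = 0"
  by (auto simp: cadj_def vec_eq_iff mat_def)

lemma ketbra_mult_vec: "ketbra v w *v u = cinner w u *s v"
  by (simp add: ketbra_def matrix_vector_mult_def cinner_def vec_eq_iff sum_distrib_left
      sum_distrib_right mult_ac)

lemma mult_ketbra: "M ** ketbra v w = ketbra (M *v v) w"
  by (simp add: ketbra_def matrix_vector_mult_def matrix_matrix_mult_def vec_eq_iff
      sum_distrib_right sum_distrib_left mult_ac)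

lemma trace_ketbra: "trace (ketbra v w) = cinner w v"
  by (simp add: trace_def ketbra_def cinner_def mult.commute)

lemma trace_mult_ketbra: "trace (M ** ketbra v w) = cinner w (M *v v)"
  by (simp add: mult_ketbra trace_ketbra)

lemma cscale_of_real: "cscale (complex_of_real r) M = r *\<^sub>R M"
  by (simp add: cscale_def vec_eq_iff scaleR_conv_of_real[where 'a=complex])

lemma cmat_eqI:
  assumes "\<And>v w. cinner v (M *v w) = cinner v (N *v w)"
  shows "M = N"
  using assms[of "axis _ 1" "axis _ 1"] by (simp add: vec_eq_iff matrix_entry_eq_cinner)

lemma matrix_mult_diff_left: "(M - N) ** K = M ** K - N ** (K :: 'n::finite cmat)"
  and matrix_mult_diff_right: "K ** (M - N) = K ** M - K ** N"
  and matrix_mult_add_left: "(M + N) ** K = M ** K + N ** K"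
  and matrix_mult_scaleR_left: "(r *\<^sub>R M) ** K = r *\<^sub>R (M ** K)"
  and matrix_mult_scaleR_right: "M ** (r *\<^sub>R K) = r *\<^sub>R (M ** K)"
  and matrix_mult_cscale_left: "cscale c M ** K = cscale c (M ** K)"
  and matrix_mult_cscale_right: "M ** cscale c K = cscale c (M ** K)"
  and matrix_mult_zero_left: "0 ** K = 0"
  and matrix_mult_zero_right: "K ** 0 = 0"
  by (simp_all add: matrix_matrix_mult_def vec_eq_iff algebra_simps sum_subtractf sum.distrib
      cscale_def sum_distrib_left scaleR_sum_right)

lemmas cmat_simps = matrix_mult_diff_left matrix_mult_diff_right matrix_mult_add_left
  matrix_add_ldistrib matrix_mult_scaleR_left matrix_mult_scaleR_right
  matrix_mult_cscale_left matrix_mult_cscale_right matrix_mult_zero_left matrix_mult_zero_right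

lemma scaleR_mult_vec: "(r *\<^sub>R (M :: 'n::finite cmat)) *v v = r *\<^sub>R (M *v v)"
  by (simp add: matrix_vector_mult_def vec_eq_iff scaleR_sum_right)

lemma trace_scaleR: "trace (r *\<^sub>R (M :: 'n::finite cmat)) = of_real r * trace M"
  and trace_cscale: "trace (cscale c M) = c * trace M"
  and trace_zero: "trace (0 :: 'n cmat) = 0"
  by (simp_all add: trace_def cscale_def sum_distrib_left scaleR_conv_of_real[where 'a=complex])

text \<open>Complex polarization: the vector \<open>v + w\<close> gives the symmetric part of the
  sesquilinear form, \<open>v + \<i> *s w\<close> the antisymmetric part, and both vanish.\<close>

lemma quadratic_form_eq_0:
  assumes "\<And>v. cinner v (M *v v) = 0"
  shows "M = 0"
proof -
  have "cinner v (M *v w) = 0" for v w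
  proof -
    have "cinner v (M *v w) + cinner w (M *v v) = 0"
      using assms[of "v + w"] assms[of v] assms[of w]
      by (simp add: cinner_linear matrix_vector_right_distrib add.commute)
    moreover have "\<i> * cinner v (M *v w) - \<i> * cinner w (M *v v) = 0"
      using assms[of "v + \<i> *s w"] assms[of v] assms[of w]
      by (simp add: cinner_linear matrix_vector_right_distrib vector_scalar_commute algebra_simps)
    ultimately show ?thesis
      by (simp add: add_eq_0_iff)
  qed
  then show ?thesis
    by (intro cmat_eqI) (simp add: cinner_linear)
qed

text \<open>Lets limits and infinite sums pass through the trace pairing; boundedness is automatic
  in finite dimension.\<close>

lemma bounded_linear_trace_mult: "bounded_linear (\<lambda>Y. trace (X ** (Y :: 'n::finite cmat)))"
  unfolding linear_conv_bounded_linear[symmetric]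
  by (intro linearI) (simp_all add: cmat_simps trace_add trace_scaleR scaleR_conv_of_real[where 'a=complex])

lemma bounded_linear_quadratic_form: "bounded_linear (\<lambda>M :: 'n::finite cmat. cinner v (M *v w))"
  unfolding linear_conv_bounded_linear[symmetric]
  by (intro linearI)
    (simp_all add: cinner_linear matrix_vector_mult_add_rdistrib scaleR_mult_vec
      scaleR_conv_of_real[where 'a=complex])

text \<open>A real quadratic form agrees with that of the adjoint, so \<open>cadj M - M\<close> has
  zero quadratic form and polarization applies.\<close>

lemma positive_op_hermitian:
  assumes "positive_op M"
  shows "cadj M = M"
proof -
  have "cinner v ((cadj M - M) *v v) = 0" for v
  proof -
    have "cnj (cinner v (M *v v)) = cinner v (M *v v)"
      using assms unfolding positive_op_def by (metis Reals_cnj_iff nonneg_Reals_Real)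
    moreover have "cinner v (cadj M *v v) = cnj (cinner v (M *v v))"
      by (simp add: cinner_adjoint[of v "cadj M"] cnj_cinner)
    ultimately show ?thesis
      by (simp add: matrix_vector_mult_diff_rdistrib cinner_linear)
  qed
  then show ?thesis
    using quadratic_form_eq_0 by fastforce
qed

section \<open>Closure properties and order of positive operators\<close>

lemma positive_op_add: "positive_op M \<Longrightarrow> positive_op N \<Longrightarrow> positive_op (M + N)"
  by (auto simp: positive_op_def matrix_vector_mult_add_rdistrib cinner_linear)

lemma positive_op_scaleR: "r \<ge> 0 \<Longrightarrow> positive_op M \<Longrightarrow> positive_op (r *\<^sub>R M)"
  by (auto simp: positive_op_def cinner_linear scaleR_mult_vec)

lemma positive_op_zero: "positive_op 0"
  by (simp add: positive_op_def cinner_linear)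

lemma positive_op_mat_1: "positive_op (mat 1)"
  by (simp add: positive_op_def cinner_self)

lemma positive_op_sum: "(\<And>i. i \<in> I \<Longrightarrow> positive_op (f i)) \<Longrightarrow> positive_op (sum f I)"
  by (induction I rule: infinite_finite_induct) (auto simp: positive_op_add positive_op_zero)

lemma positive_op_ketbra: "positive_op (ketbra v v)"
proof -
  have "cinner v w * cinner w v \<in> \<real>\<^sub>\<ge>\<^sub>0" for w
    by (metis cnj_cinner complex_norm_square nonneg_Reals_of_real_iff of_real_power zero_le_power2)
  then show ?thesis
    by (auto simp: positive_op_def ketbra_mult_vec cinner_linear)
qed

lemma positive_op_conj:
  assumes "positive_op M"
  shows "positive_op (cadj K ** M ** K)"
  using assms
  by (simp add: positive_op_def cinner_adjoint[of _ "cadj K"] flip: matrix_vector_mul_assoc)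

lemma positive_op_trace: 
  assumes "positive_op M"
  shows "trace M \<in> \<real>\<^sub>\<ge>\<^sub>0" and "M $ i $ i \<in> \<real>\<^sub>\<ge>\<^sub>0"
proof -
  show *: "M $ i $ i \<in> \<real>\<^sub>\<ge>\<^sub>0" for i
    using assms by (simp add: matrix_entry_eq_cinner positive_op_def)
  show "trace M \<in> \<real>\<^sub>\<ge>\<^sub>0"
    using * by (auto simp: trace_def complex_nonneg_Reals_iff intro!: sum_nonneg)
qed

lemma positive_op_limit:
  assumes "(f \<longlongrightarrow> M) F" "F \<noteq> bot" "\<And>n. positive_op (f n)"
  shows "positive_op M"
  unfolding positive_op_def
proof
  fix v
  have "((\<lambda>n. cinner v (f n *v v)) \<longlongrightarrow> cinner v (M *v v)) F"
    by (intro bounded_linear.tendsto[OF bounded_linear_quadratic_form] assms)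
  then show "cinner v (M *v v) \<in> \<real>\<^sub>\<ge>\<^sub>0"
    using assms by (intro Lim_in_closed_set[OF closed_nonneg_Reals_complex])
      (auto simp: positive_op_def)
qed

text \<open>A crude Cauchy-Schwarz inequality, by bounding each summand. The dimension factor is
  harmless, since only finiteness of the resulting bounds matters.\<close>

lemma cmod_cinner_le: "cmod (cinner v w) \<le> of_nat CARD('n) * (norm v * norm w)"
  for v w :: "complex ^ 'n::finite"
proof -
  have "cmod (cinner v w) \<le> (\<Sum>i\<in>(UNIV :: 'n set). norm v * norm w)"
    unfolding cinner_def
    by (intro sum_norm_le) (simp add: norm_mult mult_mono Finite_Cartesian_Product.norm_nth_le)
  then show ?thesis by simp
qed

text \<open>The quadratic form is bounded by a multiple of the squared norm. The constant is
  strictly positive so that \<open>M\<close> can later be divided by it.\<close>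

lemma positive_op_le_multiple_of_1:
  assumes "positive_op (M :: 'n::finite cmat)"
  obtains c where "c > 0" "positive_op (c *\<^sub>R mat 1 - M)"
proof -
  have "bounded_linear ((*v) M)"
    by (simp add: linear_conv_bounded_linear[symmetric])
  then obtain K where K: "K > 0" "\<And>v. norm (M *v v) \<le> norm v * K"
    using bounded_linear.pos_bounded by blast
  define c where "c = of_nat CARD('n) * K"
  have "positive_op (c *\<^sub>R mat 1 - M)"
    unfolding positive_op_def
  proof
    fix v
    let ?z = "cinner v (M *v v)"
    have z: "Im ?z = 0" "Re ?z \<ge> 0"
      using assms by (auto simp: positive_op_def complex_nonneg_Reals_iff)
    have "Re ?z \<le> cmod ?z" by (rule complex_Re_le_cmod)
    also have "\<dots> \<le> of_nat CARD('n) * (norm v * norm (M *v v))" by (rule cmod_cinner_le)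
    also have "\<dots> \<le> of_nat CARD('n) * (norm v * (norm v * K))"
      by (intro mult_left_mono K) auto
    also have "\<dots> = c * (norm v)\<^sup>2" by (simp add: c_def power2_eq_square)
    finally have "Re ?z \<le> c * (norm v)\<^sup>2" .
    then show "cinner v ((c *\<^sub>R mat 1 - M) *v v) \<in> \<real>\<^sub>\<ge>\<^sub>0"
      using z by (simp add: matrix_vector_mult_diff_rdistrib cinner_linear cinner_self
          complex_nonneg_Reals_iff scaleR_mult_vec flip: of_real_power)
  qed
  moreover have "c > 0" using K by (simp add: c_def)
  ultimately show thesis using that by blast
qed

section \<open>Null vectors of positive operators\<close>

lemma positive_op_le_null:
  assumes "positive_op M" "positive_op (c *\<^sub>R N - M)" "cinner v (N *v v) = 0"
  shows "cinner v (M *v v) = 0"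
proof -
  have "- cinner v (M *v v) \<in> \<real>\<^sub>\<ge>\<^sub>0"
    using assms(2)[unfolded positive_op_def, rule_format, of v] assms(3)
    by (simp add: matrix_vector_mult_diff_rdistrib cinner_linear scaleR_mult_vec)
  moreover have "cinner v (M *v v) \<in> \<real>\<^sub>\<ge>\<^sub>0"
    using assms(1) by (simp add: positive_op_def)
  ultimately show ?thesis
    by (simp add: complex_nonneg_Reals_iff complex_eq_iff)
qed

text \<open>The quadratic polynomial has a minimum at 0, so its derivative there vanishes. This is
  the first-order variation argument for positive forms.\<close>

lemma linear_coeff_eq_0:
  fixes a b :: real
  assumes "\<And>t. 0 \<le> t * a + t\<^sup>2 * b"
  shows "a = 0"
proof (rule ccontr)
  assume "a \<noteq> 0"
  \<comment> \<open>Since \<open>s\<close> exceeds both 0 and \<open>b\<close>, at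
    \<open>t = - a / s\<close> the linear term outweighs the quadratic one.\<close>
  define s where "s = 1 + \<bar>b\<bar>"
  have s: "s > 0" "b < s" by (auto simp: s_def)
  have "(- a / s) * a + (- a / s)\<^sup>2 * b = a\<^sup>2 / s * (b / s - 1)"
    using s by (simp add: field_simps power2_eq_square)
  moreover have "a\<^sup>2 / s > 0" using s \<open>a \<noteq> 0\<close> by simp
  moreover have "b / s - 1 < 0" using s by simp
  ultimately have "(- a / s) * a + (- a / s)\<^sup>2 * b < 0"
    by (simp only: mult_pos_neg)
  then show False using assms[of "- a / s"] by simp
qed

text \<open>The form is minimal at \<open>v\<close>; moving \<open>v\<close> in the direction
  \<open>M *v v\<close> has first-order coefficient twice the squared norm of \<open>M *v v\<close>,
  which must therefore be zero.\<close>

lemma positive_op_null_vector: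
  assumes "positive_op M" "cinner v (M *v v) = 0"
  shows "M *v v = 0"
proof -
  let ?w = "M *v v"
  have M: "cinner u (M *v w) = cinner (M *v u) w" for u w
    using positive_op_hermitian[OF assms(1)] cinner_adjoint[of u M w] by simp
  have "0 \<le> t * (2 * Re (cinner ?w ?w)) + t\<^sup>2 * Re (cinner ?w (M *v ?w))" for t :: real
  proof -
    have "cinner (v + t *\<^sub>R ?w) (M *v (v + t *\<^sub>R ?w)) \<in> \<real>\<^sub>\<ge>\<^sub>0"
      using assms(1) by (simp add: positive_op_def)
    moreover have "cinner v (M *v ?w) = cinner ?w ?w" by (rule M)
    moreover have "M *v (t *\<^sub>R ?w) = t *\<^sub>R (M *v ?w)" by (rule linear_scale) simp
    ultimately show ?thesis
      using assms(2)
      by (simp add: matrix_vector_right_distrib cinner_linear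
          complex_nonneg_Reals_iff power2_eq_square algebra_simps)
  qed
  then have "2 * Re (cinner ?w ?w) = 0" by (rule linear_coeff_eq_0)
  then show ?thesis by (simp add: cinner_self)
qed

section \<open>Norm estimates and continuity\<close>

lemma norm_cmat_le:
  fixes M :: "'n::finite cmat"
  assumes "\<And>i j. cmod (M $ i $ j) \<le> b"
  shows "norm M \<le> of_nat CARD('n) * (of_nat CARD('n) * b)"
proof -
  have "norm M \<le> (\<Sum>i\<in>(UNIV :: 'n set). norm (M $ i))"
    by (simp add: norm_vec_def[of M] L2_set_le_sum)
  also have "\<dots> \<le> (\<Sum>i\<in>(UNIV :: 'n set). of_nat CARD('n) * b)"
  proof (rule sum_mono)
    fix i
    have "norm (M $ i) \<le> (\<Sum>j\<in>UNIV. norm (M $ i $ j))"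
      by (simp add: norm_vec_def[of "M $ i"] L2_set_le_sum)
    also have "\<dots> \<le> (\<Sum>j\<in>(UNIV :: 'n set). b)"
      by (intro sum_mono assms)
    finally show "norm (M $ i) \<le> of_nat CARD('n) * b" by simp
  qed
  finally show ?thesis by simp
qed

lemma cmod_entry_le:
  assumes "\<And>v. norm (M *v v) \<le> b * norm v"
  shows "cmod (M $ i $ j) \<le> b"
proof -
  have "M $ i $ j = (M *v axis j 1) $ i"
    by (simp add: matrix_entry_eq_cinner cinner_axis)
  then have "cmod (M $ i $ j) \<le> norm (M *v axis j 1)"
    by (metis Finite_Cartesian_Product.norm_nth_le)
  also have "\<dots> \<le> b"
    using assms[of "axis j 1"] by simp
  finally show ?thesis .
qed

lemma tendsto_matrix_mult:
  fixes f g :: "'a \<Rightarrow> 'n::finite cmat"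
  assumes "(f \<longlongrightarrow> M) F" "(g \<longlongrightarrow> N) F"
  shows "((\<lambda>x. f x ** g x) \<longlongrightarrow> M ** N) F"
  unfolding matrix_matrix_mult_def
  by (intro tendsto_vec_lambda tendsto_sum tendsto_mult tendsto_vec_nth assms)

lemma tendsto_cadj:
  fixes f :: "'a \<Rightarrow> 'n::finite cmat"
  assumes "(f \<longlongrightarrow> M) F"
  shows "((\<lambda>x. cadj (f x)) \<longlongrightarrow> cadj M) F"
  unfolding cadj_def
  by (intro tendsto_vec_lambda tendsto_cnj tendsto_vec_nth assms)

section \<open>Square roots of positive operators\<close>

text \<open>A fixed point \<open>L\<close> of this iteration satisfies
  \<open>(mat 1 - L) ** (mat 1 - L) = mat 1 - P\<close>. With \<open>P = mat 1 - A\<close> it yields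
  the square root \<open>mat 1 - L\<close> of \<open>A\<close>.\<close>

primrec sqrt_iter :: "'n::finite cmat \<Rightarrow> nat \<Rightarrow> 'n cmat" where
  "sqrt_iter P 0 = 0"
| "sqrt_iter P (Suc n) = (1/2) *\<^sub>R (P + sqrt_iter P n ** sqrt_iter P n)"

text \<open>The same iteration at the scalar 1. Its values and increments majorize those of the
  matrix iteration for a contraction \<open>P\<close>.\<close>

primrec sqrt_iter_real :: "nat \<Rightarrow> real" where
  "sqrt_iter_real 0 = 0"
| "sqrt_iter_real (Suc n) = (1 + (sqrt_iter_real n)\<^sup>2) / 2"

lemma sqrt_iter_real_bounds: "0 \<le> sqrt_iter_real n" "sqrt_iter_real n \<le> 1"
  "sqrt_iter_real n \<le> sqrt_iter_real (Suc n)"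
proof -
  show *: "0 \<le> sqrt_iter_real n" for n by (induction n) auto
  show "sqrt_iter_real n \<le> 1" by (induction n) (auto simp: * power_le_one)
  show "sqrt_iter_real n \<le> sqrt_iter_real (Suc n)"
    using sum_squares_bound[of "sqrt_iter_real n" 1] by simp
qed

text \<open>Each iterate is a polynomial in \<open>P\<close>.\<close>

lemma sqrt_iter_commute:
  assumes "C ** P = P ** C"
  shows "C ** sqrt_iter P n = sqrt_iter P n ** C"
proof (induction n)
  case (Suc n)
  let ?Y = "sqrt_iter P n"
  have "C ** (?Y ** ?Y) = (?Y ** ?Y) ** C"
    using Suc by (metis matrix_mul_assoc)
  then have "C ** (P + ?Y ** ?Y) = (P + ?Y ** ?Y) ** C"
    by (simp only: cmat_simps assms)
  then show ?case
    by (simp only: sqrt_iter.simps matrix_mult_scaleR_left matrix_mult_scaleR_right)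
qed (simp add: cmat_simps)

lemma cadj_sqrt_iter:
  assumes "cadj P = P"
  shows "cadj (sqrt_iter P n) = sqrt_iter P n"
  by (induction n) (simp_all add: cadj_zero cadj_scaleR cadj_add cadj_mult assms
      del: scaleR_add_right)

context
  fixes P :: "'n::finite cmat"
  assumes contraction: "\<And>v. norm (P *v v) \<le> norm v"
begin

lemma norm_sqrt_iter_le: "norm (sqrt_iter P n *v v) \<le> sqrt_iter_real n * norm v"
proof (induction n arbitrary: v)
  case (Suc n)
  let ?Y = "sqrt_iter P n" and ?y = "sqrt_iter_real n"
  have "norm ((P + ?Y ** ?Y) *v v) \<le> norm (P *v v) + norm (?Y *v (?Y *v v))"
    by (simp add: matrix_vector_mult_add_rdistrib matrix_vector_mul_assoc norm_triangle_ineq)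
  also have "norm (?Y *v (?Y *v v)) \<le> ?y * norm (?Y *v v)" by (rule Suc)
  also have "?y * norm (?Y *v v) \<le> ?y * (?y * norm v)"
    by (intro mult_left_mono Suc sqrt_iter_real_bounds)
  finally have "norm ((P + ?Y ** ?Y) *v v) \<le> norm v + ?y * (?y * norm v)"
    using contraction[of v] by simp
  moreover have "norm (sqrt_iter P (Suc n) *v v) = norm ((P + ?Y ** ?Y) *v v) / 2"
    by (simp add: scaleR_mult_vec)
  ultimately show ?case
    by (simp add: power2_eq_square algebra_simps)
qed simp

lemma norm_sqrt_iter_diff_le:
  "norm ((sqrt_iter P (Suc n) - sqrt_iter P n) *v v)
     \<le> (sqrt_iter_real (Suc n) - sqrt_iter_real n) * norm v"
proof (induction n arbitrary: v)
  case 0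
  show ?case using contraction[of v] by (simp add: scaleR_mult_vec)
next
  case (Suc n)
  let ?Y = "sqrt_iter P n" and ?Y' = "sqrt_iter P (Suc n)"
  let ?y = "sqrt_iter_real n" and ?y' = "sqrt_iter_real (Suc n)"
  let ?w = "(?Y' - ?Y) *v v"
  have comm: "?Y ** ?Y' = ?Y' ** ?Y"
    by (intro sqrt_iter_commute sqrt_iter_commute[symmetric] refl)
  have "sqrt_iter P (Suc (Suc n)) - ?Y' = (1/2) *\<^sub>R (?Y' ** ?Y' - ?Y ** ?Y)"
    by (simp add: scaleR_diff_right scaleR_add_right del: sqrt_iter.simps)
      (simp add: scaleR_diff_right scaleR_add_right)
  \<comment> \<open>The difference of squares factors because the iterates commute; the scalar
    iteration factors in the same way, so the bounds match.\<close>
  also have "?Y' ** ?Y' - ?Y ** ?Y = (?Y' + ?Y) ** (?Y' - ?Y)"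
    using comm by (simp add: cmat_simps del: sqrt_iter.simps)
  finally have eq: "(sqrt_iter P (Suc (Suc n)) - ?Y') *v v = (1/2) *\<^sub>R ((?Y' + ?Y) *v ?w)"
    by (simp only: scaleR_mult_vec matrix_vector_mul_assoc)
  have "norm ((?Y' + ?Y) *v ?w) \<le> norm (?Y' *v ?w) + norm (?Y *v ?w)"
    by (simp only: matrix_vector_mult_add_rdistrib norm_triangle_ineq)
  also have "\<dots> \<le> ?y' * norm ?w + ?y * norm ?w"
    by (intro add_mono norm_sqrt_iter_le)
  also have "\<dots> = (?y' + ?y) * norm ?w" by (simp only: distrib_right)
  also have "\<dots> \<le> (?y' + ?y) * ((?y' - ?y) * norm v)"
    by (intro mult_left_mono Suc add_nonneg_nonneg sqrt_iter_real_bounds)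
  also have "\<dots> = 2 * ((sqrt_iter_real (Suc (Suc n)) - ?y') * norm v)"
  proof -
    have "(a + b) * ((a - b) * c) = 2 * (((1 + a\<^sup>2) / 2 - (1 + b\<^sup>2) / 2) * c)" for a b c :: real
      by (simp add: field_simps power2_eq_square)
    then show ?thesis by (simp only: sqrt_iter_real.simps)
  qed
  finally show ?case unfolding eq by (simp del: sqrt_iter.simps sqrt_iter_real.simps)
qed

text \<open>The increments have a summable majorant: the telescoping series of the bounded
  increasing scalar iteration, times the squared dimension that converts operator bounds into matrix
  norms.\<close>

lemma sqrt_iter_converges: "\<exists>L. sqrt_iter P \<longlonglongrightarrow> L"
proof -
  have "incseq sqrt_iter_real"
    by (intro incseq_SucI sqrt_iter_real_bounds)
  then obtain l where "sqrt_iter_real \<longlonglongrightarrow> l"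
    using incseq_convergent[of sqrt_iter_real 1] sqrt_iter_real_bounds(2) by metis
  then have "summable (\<lambda>n. sqrt_iter_real (Suc n) - sqrt_iter_real n)"
    by (rule telescope_summable)
  then have "summable (\<lambda>n. of_nat CARD('n) * (of_nat CARD('n) * (sqrt_iter_real (Suc n) - sqrt_iter_real n)))"
    by (rule summable_mult[OF summable_mult])
  moreover have "norm (sqrt_iter P (Suc n) - sqrt_iter P n)
      \<le> of_nat CARD('n) * (of_nat CARD('n) * (sqrt_iter_real (Suc n) - sqrt_iter_real n))" for n
    by (rule norm_cmat_le, rule cmod_entry_le, rule norm_sqrt_iter_diff_le)
  ultimately have "summable (\<lambda>n. sqrt_iter P (Suc n) - sqrt_iter P n)"
    by (rule summable_comparison_test'[where N = 0])
  then have "(\<lambda>n. \<Sum>i<n. sqrt_iter P (Suc i) - sqrt_iter P i) \<longlonglongrightarrow> (\<Sum>n. sqrt_iter P (Suc n) - sqrt_iter P n)"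
    by (rule summable_LIMSEQ)
  moreover have "(\<Sum>i<n. sqrt_iter P (Suc i) - sqrt_iter P i) = sqrt_iter P n" for n
    by (subst sum_lessThan_telescope) simp
  ultimately show ?thesis by auto
qed

end

lemma positive_contraction_norm_le:
  assumes A: "positive_op A" and A1: "positive_op (mat 1 - A)"
  shows "norm ((mat 1 - A) *v v) \<le> norm v"
proof -
  let ?P = "mat 1 - A"
  have P: "cadj ?P = ?P" using A1 by (rule positive_op_hermitian)
  have "positive_op (cadj ?P ** A ** ?P)" "positive_op (cadj A ** ?P ** A)"
    using A A1 positive_op_conj by blast+
  \<comment> \<open>With \<open>P = mat 1 - A\<close>, the operator \<open>mat 1 - P ** P\<close>
    equals the sum \<open>P ** A ** P + A ** P ** A + A\<close> of positive operators, which gives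
    the contraction property.\<close>
  then have "positive_op (cadj ?P ** A ** ?P + cadj A ** ?P ** A + A)"
    using A by (intro positive_op_add)
  also have "cadj ?P ** A ** ?P + cadj A ** ?P ** A + A = mat 1 - ?P ** ?P"
    unfolding P positive_op_hermitian[OF A] by (simp add: cmat_simps matrix_mul_assoc)
  finally have "cinner v ((mat 1 - ?P ** ?P) *v v) \<in> \<real>\<^sub>\<ge>\<^sub>0"
    by (simp add: positive_op_def)
  moreover have "cinner v ((mat 1 - ?P ** ?P) *v v) = cinner v v - cinner (?P *v v) (?P *v v)"
    using cinner_adjoint[of v ?P "?P *v v"] P
    by (simp only: matrix_vector_mult_diff_rdistrib[of "mat 1" "?P ** ?P"] cinner_linear
        matrix_vector_mul_lid matrix_vector_mul_assoc)
  ultimately have "(norm (?P *v v))\<^sup>2 \<le> (norm v)\<^sup>2"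
    by (simp add: cinner_self complex_nonneg_Reals_iff flip: of_real_power)
  then show ?thesis by simp
qed

lemma positive_op_sqrt_le_1:
  assumes A: "positive_op A" and A1: "positive_op (mat 1 - A)"
  shows "\<exists>S. cadj S = S \<and> S ** S = A \<and> (\<forall>C. C ** A = A ** C \<longrightarrow> C ** S = S ** C)"
proof -
  let ?P = "mat 1 - A"
  obtain L where L: "sqrt_iter ?P \<longlonglongrightarrow> L"
    using sqrt_iter_converges positive_contraction_norm_le[OF A A1] by blast
  have "(\<lambda>n. sqrt_iter ?P (Suc n)) \<longlonglongrightarrow> (1/2) *\<^sub>R (?P + L ** L)"
    unfolding sqrt_iter.simps by (intro tendsto_intros tendsto_matrix_mult L)
  then have "L = (1/2) *\<^sub>R (?P + L ** L)"
    using LIMSEQ_Suc[OF L] LIMSEQ_unique by blast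
  then have "2 *\<^sub>R L = 2 *\<^sub>R ((1/2) *\<^sub>R (?P + L ** L))" by (rule arg_cong)
  then have LL: "L + L = ?P + L ** L" by (simp add: scaleR_2)
  have "(mat 1 - L) ** (mat 1 - L) = mat 1 - (L + L) + L ** L"
    by (simp add: cmat_simps algebra_simps)
  also have "\<dots> = A" unfolding LL by simp
  finally have "(mat 1 - L) ** (mat 1 - L) = A" .
  moreover have "cadj L = L"
  proof (rule LIMSEQ_unique[OF _ L])
    show "sqrt_iter ?P \<longlonglongrightarrow> cadj L"
      using tendsto_cadj[OF L] cadj_sqrt_iter[OF positive_op_hermitian[OF A1]] by simp
  qed
  moreover have "C ** (mat 1 - L) = (mat 1 - L) ** C" if comm: "C ** A = A ** C" for C
  proof -
    have "C ** L = L ** C"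
    proof (rule LIMSEQ_unique)
      show "(\<lambda>n. C ** sqrt_iter ?P n) \<longlonglongrightarrow> C ** L"
        by (intro tendsto_matrix_mult tendsto_const L)
      have "C ** sqrt_iter ?P n = sqrt_iter ?P n ** C" for n
        by (intro sqrt_iter_commute) (simp add: cmat_simps comm)
      moreover have "(\<lambda>n. sqrt_iter ?P n ** C) \<longlonglongrightarrow> L ** C"
        by (intro tendsto_matrix_mult tendsto_const L)
      ultimately show "(\<lambda>n. C ** sqrt_iter ?P n) \<longlonglongrightarrow> L ** C"
        by presburger
    qed
    then show ?thesis
      by (simp add: cmat_simps)
  qed
  ultimately show ?thesis
    by (intro exI[of _ "mat 1 - L"]) (metis cadj_diff cadj_mat_1)
qed

text \<open>Rescaling by \<open>1 / c\<close> reduces to the case below the identity. The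
  commutation clause is what later carries commutation with an effect over to its Lueders
  operator.\<close>

lemma positive_op_sqrt:
  fixes A :: "'n::finite cmat"
  assumes A: "positive_op A"
  obtains S where "cadj S = S" "S ** S = A" "\<And>C. C ** A = A ** C \<Longrightarrow> C ** S = S ** C"
proof -
  obtain c where c: "c > 0" "positive_op (c *\<^sub>R mat 1 - A)"
    using positive_op_le_multiple_of_1[OF A] .
  have "positive_op ((1/c) *\<^sub>R A)" "positive_op ((1/c) *\<^sub>R (c *\<^sub>R mat 1 - A))"
    using A c by (auto intro: positive_op_scaleR)
  moreover have "(1/c) *\<^sub>R (c *\<^sub>R mat 1 - A) = mat 1 - (1/c) *\<^sub>R A"
    using c by (simp add: scaleR_diff_right)
  ultimately obtain S where S: "cadj S = S" "S ** S = (1/c) *\<^sub>R A"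
    "\<forall>C. C ** ((1/c) *\<^sub>R A) = ((1/c) *\<^sub>R A) ** C \<longrightarrow> C ** S = S ** C"
    using positive_op_sqrt_le_1 by metis
  show thesis
  proof (rule that[of "sqrt c *\<^sub>R S"])
    show "cadj (sqrt c *\<^sub>R S) = sqrt c *\<^sub>R S"
      by (simp only: S(1) cadj_scaleR)
    show "(sqrt c *\<^sub>R S) ** (sqrt c *\<^sub>R S) = A"
      using c by (simp add: S(2) matrix_mult_scaleR_left matrix_mult_scaleR_right)
    show "C ** (sqrt c *\<^sub>R S) = (sqrt c *\<^sub>R S) ** C" if "C ** A = A ** C" for C
      using S(3) that by (simp only: matrix_mult_scaleR_left matrix_mult_scaleR_right)
  qed
qed

section \<open>Traces and norms of positive operators\<close>

lemma trace_mult_positive: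
  assumes "positive_op M" "positive_op N"
  shows "trace (M ** N) \<in> \<real>\<^sub>\<ge>\<^sub>0"
proof -
  obtain S where S: "cadj S = S" "S ** S = M"
    using positive_op_sqrt[OF assms(1)] by metis
  have "trace (M ** N) = trace (cadj S ** N ** S)"
    using S trace_mul_sym[of S "S ** N"] by (simp add: matrix_mul_assoc)
  then show ?thesis
    by (simp only: positive_op_trace positive_op_conj assms)
qed

text \<open>Nonnegative diagonal entries with sum zero vanish, so every basis vector is a null
  vector of the form and hence is killed by \<open>M\<close>.\<close>

lemma positive_op_trace_eq_0:
  assumes "positive_op M" "trace M = 0"
  shows "M = 0"
proof -
  have "\<forall>i\<in>UNIV. M $ i $ i = 0"
  proof -
    have *: "Re (M $ i $ i) \<ge> 0" "Im (M $ i $ i) = 0" for i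
      using positive_op_trace(2)[OF assms(1), of i] by (auto simp: complex_nonneg_Reals_iff)
    have "(\<Sum>i\<in>UNIV. Re (M $ i $ i)) = 0"
      using assms(2) unfolding trace_def Re_sum[symmetric] by simp
    then have "\<forall>i\<in>UNIV. Re (M $ i $ i) = 0"
      using sum_nonneg_eq_0_iff[of UNIV "\<lambda>i. Re (M $ i $ i)"] *(1) by simp
    then show ?thesis using * by (simp add: complex_eq_iff)
  qed
  then have "M *v axis i 1 = 0" for i
    using positive_op_null_vector[OF assms(1), of "axis i 1"] matrix_entry_eq_cinner[of M i i] by simp
  then have "M $ i $ j = 0" for i j
    unfolding matrix_entry_eq_cinner[of M] by (simp add: cinner_linear)
  then show ?thesis by (simp add: vec_eq_iff)
qed

text \<open>The entries are the numbers \<open>cinner (S *v e) (Y *v (S *v f))\<close> for basis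
  vectors \<open>e\<close>, \<open>f\<close>, and the trace of \<open>S ** S\<close> is the sum of
  the squared norms of the \<open>S *v e\<close>. This bounds positive operators by their trace and
  makes the Lueders sum converge.\<close>

lemma norm_sandwich_le:
  fixes S Y :: "'n::finite cmat"
  assumes S: "cadj S = S" and K: "K \<ge> 0" "\<And>v. norm (Y *v v) \<le> norm v * K"
  shows "norm (S ** Y ** S) \<le> of_nat (CARD('n) ^ 3) * K * Re (trace (S ** S))"
proof -
  let ?d = "of_nat CARD('n) :: real" and ?n = "\<lambda>i. norm (S *v axis i 1)"
  have SS: "(S ** S) $ i $ i = of_real ((?n i)\<^sup>2)" for i
    unfolding matrix_entry_eq_cinner matrix_vector_mul_assoc[symmetric]
    by (subst cinner_adjoint) (simp only: S cinner_self)
  have n: "(?n i)\<^sup>2 \<le> Re (trace (S ** S))" for i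
    unfolding trace_def SS Re_sum Re_complex_of_real by (rule member_le_sum) auto
  have "cmod ((S ** Y ** S) $ i $ j) \<le> ?d * K * Re (trace (S ** S))" for i j
  proof -
    have "(S ** Y ** S) $ i $ j = cinner (S *v axis i 1) (Y *v (S *v axis j 1))"
      unfolding matrix_entry_eq_cinner matrix_vector_mul_assoc[symmetric]
      by (subst cinner_adjoint) (simp only: S)
    then have "cmod ((S ** Y ** S) $ i $ j) \<le> ?d * (?n i * norm (Y *v (S *v axis j 1)))"
      by (simp only: cmod_cinner_le)
    also have "\<dots> \<le> ?d * (?n i * (?n j * K))"
      by (intro mult_left_mono K) auto
    also have "\<dots> = ?d * K * (?n i * ?n j)" by simp
    also have "\<dots> \<le> ?d * K * Re (trace (S ** S))"
    proof (rule mult_left_mono)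
      show "?n i * ?n j \<le> Re (trace (S ** S))"
        using sum_squares_bound[of "?n i" "?n j"] n[of i] n[of j] by linarith
    qed (use K in simp)
    finally show ?thesis .
  qed
  then have "norm (S ** Y ** S) \<le> ?d * (?d * (?d * K * Re (trace (S ** S))))"
    by (rule norm_cmat_le)
  then show ?thesis by (simp add: power3_eq_cube mult_ac)
qed

lemma positive_op_norm_le:
  fixes M :: "'n::finite cmat"
  assumes "positive_op M"
  shows "norm M \<le> of_nat (CARD('n) ^ 3) * Re (trace M)"
proof -
  obtain S where S: "cadj S = S" "S ** S = M"
    using positive_op_sqrt[OF assms(1)] by metis
  then show ?thesis
    using norm_sandwich_le[of S 1 "mat 1"] by simp
qed

section \<open>Fixed points of channels\<close>

lemma clinear_mapI:
  assumes "\<And>X Y. f (X + Y) = f X + f Y" "\<And>c X. f (cscale c X) = cscale c (f X)"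
  shows "clinear_map f"
  by (simp add: Vector_Spaces.linear_iff assms cmat.vector_space_axioms)

lemma clinear_mapD:
  assumes "clinear_map f"
  shows "f (X + Y) = f X + f Y" "f (X - Y) = f X - f Y" "f (cscale c X) = cscale c (f X)"
    "f (r *\<^sub>R X) = r *\<^sub>R f X" "f (sum g I) = (\<Sum>i\<in>I. f (g i))"
proof -
  interpret f: Vector_Spaces.linear cscale cscale f by fact
  show "f (X + Y) = f X + f Y" "f (X - Y) = f X - f Y" "f (cscale c X) = cscale c (f X)"
    "f (sum g I) = (\<Sum>i\<in>I. f (g i))"
    by (rule f.add f.diff f.scale f.sum)+
  show "f (r *\<^sub>R X) = r *\<^sub>R f X"
    using f.scale[of "complex_of_real r"] by (simp add: cscale_of_real)
qed

lemma clinear_map_conj: "clinear_map (\<lambda>X. K ** X ** L)"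
  by (intro clinear_mapI) (simp_all add: cmat_simps)

text \<open>A basis chosen inside \<open>S\<close> is mapped injectively onto an independent subset
  of the span of \<open>U\<close>.\<close>

lemma cmat_dim_le_card:
  fixes f :: "'n::finite cmat \<Rightarrow> 'n cmat"
  assumes f: "clinear_map f" and inj: "\<And>X. X \<in> cmat.span S \<Longrightarrow> f X = 0 \<Longrightarrow> X = 0"
    and im: "\<And>X. f X \<in> cmat.span U" and U: "finite U"
  shows "cmat.dim (cmat.span S) \<le> card U"
proof -
  interpret f: Vector_Spaces.linear cscale cscale f by fact
  interpret cmat_pair: vector_space_pair "cscale :: _ \<Rightarrow> 'n cmat \<Rightarrow> _" "cscale :: _ \<Rightarrow> 'n cmat \<Rightarrow> _" ..
  obtain C where C: "C \<subseteq> S" "cmat.independent C" "S \<subseteq> cmat.span C" "card C = cmat.dim S"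
    by (rule cmat.basis_exists[of S])
  have CS: "cmat.span C \<subseteq> cmat.span S" by (intro cmat.span_mono C)
  have inj_span: "inj_on f (cmat.span C)"
  proof (rule inj_onI)
    fix X Y assume XY: "X \<in> cmat.span C" "Y \<in> cmat.span C" "f X = f Y"
    have "X - Y \<in> cmat.span S"
      by (rule cmat.span_diff) (use CS XY in \<open>simp_all add: subset_iff\<close>)
    moreover have "f (X - Y) = 0" using XY(3) by (simp add: f.diff)
    ultimately have "X - Y = 0" by (rule inj)
    then show "X = Y" by simp
  qed
  have "cmat.independent (f ` C)"
    using cmat_pair.linear_independent_injective_image[OF f C(2) inj_span] .
  moreover have "f ` C \<subseteq> cmat.span U" using im by blast
  ultimately have "card (f ` C) \<le> card U"
    using cmat.independent_span_bound[OF U, of "f ` C"] by simp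
  moreover have "card (f ` C) = card C"
    by (rule card_image, rule inj_on_subset[OF inj_span cmat.span_superset])
  ultimately show ?thesis using C by simp
qed

text \<open>For positive operators the trace controls the norm, so Bolzano-Weierstrass
  applies.\<close>

lemma bounded_positive_subseq:
  fixes f :: "nat \<Rightarrow> 'n::finite cmat"
  assumes "\<And>n. positive_op (f n)" "\<And>n. trace (f n) = t"
  obtains L r where "strict_mono r" "(f \<circ> r) \<longlonglongrightarrow> L" "positive_op L"
proof -
  have "norm (f n) \<le> of_nat (CARD('n) ^ 3) * Re t" for n
    using positive_op_norm_le[OF assms(1)[of n]] assms(2)[of n] by simp
  then have "bounded (range f)"
    unfolding bounded_iff by blast
  then obtain L r where L: "strict_mono r" "(f \<circ> r) \<longlonglongrightarrow> L"
    using bounded_imp_convergent_subsequence by blast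
  moreover have "positive_op L"
    using L(2) by (rule positive_op_limit) (simp_all add: assms)
  ultimately show thesis using that by blast
qed

lemma cscale_scaleR: "cscale c (r *\<^sub>R M) = r *\<^sub>R cscale c M"
  by (simp add: cscale_def vec_eq_iff)

section \<open>Positive trace-preserving maps and their Cesaro means\<close>

locale channel =
  fixes T :: "'n::finite cmat \<Rightarrow> 'n cmat"
  assumes clinear: "clinear_map T"
    and positive: "positive_op Y \<Longrightarrow> positive_op (T Y)"
    and trace_preserving: "trace (T Y) = trace Y"
begin

lemma funpow: "channel (T ^^ k)"
proof (induction k)
  case 0
  show ?case by unfold_locales (simp_all add: clinear_mapI)
next
  case (Suc k)
  then interpret k: channel "T ^^ k" .
  show ?case
    by unfold_locales
      (auto intro!: clinear_mapI positive k.positive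
        simp: trace_preserving k.trace_preserving clinear_mapD[OF clinear] clinear_mapD[OF k.clinear])
qed

text \<open>The average of the powers 0 to \<open>n\<close>; counting \<open>Suc n\<close> terms
  keeps the denominator nonzero.\<close>

definition cesaro :: "nat \<Rightarrow> 'n cmat \<Rightarrow> 'n cmat" where
  "cesaro n Y = (1 / real (Suc n)) *\<^sub>R (\<Sum>k<Suc n. (T ^^ k) Y)"

lemma trace_mult_cesaro:
  "trace (X ** cesaro n Y) = of_real (1 / real (Suc n)) * (\<Sum>k<Suc n. trace (X ** (T ^^ k) Y))"
proof -
  interpret bounded_linear "\<lambda>Y. trace (X ** Y)"
    by (rule bounded_linear_trace_mult)
  show ?thesis
    unfolding cesaro_def scaleR sum by (rule scaleR_conv_of_real)
qed

text \<open>Serves trace preservation, with \<open>X = mat 1\<close>, and the invariance of the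
  functional given by a fixed point \<open>X\<close> of the dual map.\<close>

lemma trace_mult_cesaro_const:
  assumes "\<And>k. trace (X ** (T ^^ k) Y) = c"
  shows "trace (X ** cesaro n Y) = c"
proof -
  have "(\<Sum>k<Suc n. trace (X ** (T ^^ k) Y)) = of_nat (Suc n) * c"
    by (simp only: assms sum_constant card_lessThan)
  moreover have "of_real (1 / real (Suc n)) * of_nat (Suc n) = (1 :: complex)"
    by (simp del: of_nat_Suc)
  ultimately show ?thesis
    by (simp only: trace_mult_cesaro mult.assoc[symmetric] mult_1_left)
qed

lemma channel_cesaro: "channel (cesaro n)"
proof (rule channel.intro)
  show "clinear_map (cesaro n)"
  proof (rule clinear_mapI)
    fix X Y and c
    show "cesaro n (X + Y) = cesaro n X + cesaro n Y"
      by (simp add: cesaro_def clinear_mapD[OF channel.clinear[OF funpow]] sum.distrib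
          scaleR_add_right del: of_nat_Suc sum.lessThan_Suc funpow.simps)
    show "cesaro n (cscale c X) = cscale c (cesaro n X)"
      by (simp add: cesaro_def clinear_mapD[OF channel.clinear[OF funpow]] cscale_scaleR
          cmat.scale_sum_right del: of_nat_Suc sum.lessThan_Suc funpow.simps)
  qed
  show "positive_op (cesaro n Y)" if "positive_op Y" for Y
    unfolding cesaro_def
    by (intro positive_op_scaleR positive_op_sum channel.positive[OF funpow] that) simp
  show "trace (cesaro n Y) = trace Y" for Y
    using trace_mult_cesaro_const[of "mat 1" Y "trace Y" n] channel.trace_preserving[OF funpow]
    by (simp only: matrix_mul_lid)
qed

lemma trace_mult_funpow:
  assumes "\<And>Y. trace (X ** T Y) = trace (X ** Y)"
  shows "trace (X ** (T ^^ k) Y) = trace (X ** Y)"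
proof (induction k)
  case (Suc k)
  have "trace (X ** (T ^^ Suc k) Y) = trace (X ** T ((T ^^ k) Y))" by simp
  also have "\<dots> = trace (X ** (T ^^ k) Y)" by (rule assms)
  finally show ?case using Suc by simp
qed simp

text \<open>A null vector of the limit point \<open>\<rho>\<close> of the Cesaro means of the identity is also a null
  vector of every limit point of the Cesaro means of any positive operator.\<close>

lemma fixed_eq_0_if_compression_eq_0:
  assumes r: "strict_mono r" and \<rho>: "(\<lambda>n. cesaro (r n) (mat 1)) \<longlonglongrightarrow> \<rho>"
    and v: "cinner v (\<rho> *v v) = 0"
    and R: "R = mat 1 - ketbra v w"
    and X: "\<And>Y. trace (X ** T Y) = trace (X ** Y)"
    and RXR: "R ** X ** cadj R = 0"
  shows "X = 0"
proof (rule quadratic_form_eq_0)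
  fix u :: "complex ^ 'n"
  let ?Y = "ketbra u u"
  have Y: "positive_op ?Y" by (rule positive_op_ketbra)
  obtain c where c: "positive_op (c *\<^sub>R mat 1 - ?Y)"
    using positive_op_le_multiple_of_1[OF Y] by blast
  note C = channel.positive[OF channel_cesaro] channel.trace_preserving[OF channel_cesaro]
  \<comment> \<open>A further subsequence makes the means of \<open>?Y\<close> converge as well,
    while those of the identity still tend to \<open>\<rho>\<close>.\<close>
  obtain L s where s: "strict_mono s" and L: "((\<lambda>n. cesaro (r n) ?Y) \<circ> s) \<longlonglongrightarrow> L" "positive_op L"
    using bounded_positive_subseq[of "\<lambda>n. cesaro (r n) ?Y" "trace ?Y"] C Y by metis
  have "((\<lambda>n. cesaro (r n) (mat 1)) \<circ> s) \<longlonglongrightarrow> \<rho>"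
    using LIMSEQ_subseq_LIMSEQ[OF \<rho> s] .
  then have "(\<lambda>n. c *\<^sub>R ((\<lambda>n. cesaro (r n) (mat 1)) \<circ> s) n - ((\<lambda>n. cesaro (r n) ?Y) \<circ> s) n)
      \<longlonglongrightarrow> c *\<^sub>R \<rho> - L"
    by (intro tendsto_intros L)
  \<comment> \<open>The order relation between \<open>?Y\<close> and
    \<open>c *\<^sub>R mat 1\<close> is preserved by the Cesaro means and by the limit, so
    \<open>v\<close> is also a null vector of \<open>L\<close>.\<close>
  then have "positive_op (c *\<^sub>R \<rho> - L)"
  proof (rule positive_op_limit)
    fix n
    have "positive_op (cesaro (r (s n)) (c *\<^sub>R mat 1 - ?Y))"
      by (intro C c)
    then show "positive_op (c *\<^sub>R ((\<lambda>n. cesaro (r n) (mat 1)) \<circ> s) n - ((\<lambda>n. cesaro (r n) ?Y) \<circ> s) n)"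
      by (simp add: clinear_mapD[OF channel.clinear[OF channel_cesaro]])
  qed simp
  then have "cinner v (L *v v) = 0"
    using positive_op_le_null L(2) v by blast
  then have Lv: "L *v v = 0"
    using positive_op_null_vector L(2) by blast
  have "ketbra 0 w = 0" by (simp add: ketbra_def vec_eq_iff)
  \<comment> \<open>\<open>R\<close> differs from the identity by an operator with range spanned by
    \<open>v\<close>, which \<open>L\<close> kills. Hence \<open>L\<close> equals
    \<open>cadj R ** L ** R\<close> and pairs with \<open>X\<close> only through the compression
    \<open>R ** X ** cadj R\<close>.\<close>
  then have LR: "L = L ** R"
    unfolding R by (simp add: cmat_simps mult_ketbra Lv)
  have "L = cadj L" using positive_op_hermitian[OF L(2)] by simp
  also have "\<dots> = cadj R ** L"
    by (subst LR) (simp add: cadj_mult positive_op_hermitian[OF L(2)])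
  finally have RL: "L = cadj R ** L" .
  have "trace (X ** L) = trace (X ** (cadj R ** (L ** R)))"
    using LR RL by simp
  also have "\<dots> = trace (R ** (X ** cadj R ** L))"
    by (subst trace_mul_sym[of R]) (simp add: matrix_mul_assoc)
  also have "\<dots> = 0"
    using RXR by (simp add: matrix_mul_assoc matrix_mult_zero_left trace_zero)
  finally have XL: "trace (X ** L) = 0" .
  \<comment> \<open>As \<open>X\<close> is fixed by the dual map, its pairing is constant along the
    means, so \<open>trace (X ** ?Y)\<close> equals its limit 0.\<close>
  have "(\<lambda>n. trace (X ** ((\<lambda>n. cesaro (r n) ?Y) \<circ> s) n)) \<longlonglongrightarrow> trace (X ** L)"
    by (intro bounded_linear.tendsto[OF bounded_linear_trace_mult] L)
  moreover have "trace (X ** ((\<lambda>n. cesaro (r n) ?Y) \<circ> s) n) = trace (X ** ?Y)" for n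
    using trace_mult_cesaro_const[of X ?Y "trace (X ** ?Y)"] trace_mult_funpow[OF X] by simp
  ultimately have "(\<lambda>n :: nat. trace (X ** ?Y)) \<longlonglongrightarrow> 0"
    by (simp only: XL)
  then have "trace (X ** ?Y) = 0"
    by (rule LIMSEQ_unique[OF tendsto_const])
  then show "cinner u (X *v u) = 0" by (simp only: trace_mult_ketbra)
qed

text \<open>Compression along the null vector is injective on the fixed points of the dual map, and
  its values have one zero row and one zero column.\<close>

lemma dim_fixed_le_if_limit_degenerate:
  assumes r: "strict_mono r" and \<rho>: "(\<lambda>n. cesaro (r n) (mat 1)) \<longlonglongrightarrow> \<rho>"
    and v: "cinner v (\<rho> *v v) = 0" "v \<noteq> 0"
    and S: "\<And>X Y. X \<in> S \<Longrightarrow> trace (X ** T Y) = trace (X ** Y)"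
  shows "cmat.dim (cmat.span S) \<le> (CARD('n) - 1)\<^sup>2"
proof -
  obtain i where i: "v $ i \<noteq> 0" using v(2) by (metis vec_eq_iff zero_index)
  \<comment> \<open>The oblique projection along \<open>v\<close> onto the vectors with zero
    \<open>i\<close>-th coordinate; the scaling by \<open>1 / v $ i\<close> makes row
    \<open>i\<close> of \<open>R\<close> vanish.\<close>
  define R where "R = mat 1 - ketbra v (cnj (1 / v $ i) *s axis i 1)"
  have Ri: "R $ i $ j = 0" for j
    using i by (simp add: R_def ketbra_def mat_def axis_def)
  define U where "U = (\<lambda>(k, l). matrix_unit k l :: 'n cmat) ` ((UNIV - {i}) \<times> (UNIV - {i}))"
  let ?f = "\<lambda>X. R ** X ** cadj R"
  have "cmat.dim (cmat.span S) \<le> card U"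
  proof (rule cmat_dim_le_card)
    show "clinear_map ?f" by (rule clinear_map_conj)
    show "finite U" by (simp add: U_def)
    show "?f X \<in> cmat.span U" for X
    proof -
      have "(R ** M) $ i $ j = 0" "(M ** cadj R) $ j $ i = 0" for M j
        by (simp_all add: matrix_matrix_mult_def cadj_def Ri)
      then have 0: "?f X $ i $ j = 0" "?f X $ j $ i = 0" for j
        by (metis matrix_mul_assoc)+
      have "cscale (?f X $ k $ l) (matrix_unit k l) \<in> cmat.span U" for k l
      proof (cases "k = i \<or> l = i")
        case True
        then show ?thesis using 0 by (auto simp: cmat.span_zero)
      next
        case False
        then have "matrix_unit k l \<in> U" by (auto simp: U_def)
        then show ?thesis by (intro cmat.span_scale cmat.span_base)
      qed
      then show ?thesis
        by (subst matrix_unit_expansion) (intro cmat.span_sum)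
    qed
    fix X assume X: "X \<in> cmat.span S" and 0: "?f X = 0"
    have "trace (X ** T Y) = trace (X ** Y)" for Y
      using X
    proof (induction rule: cmat.span_induct_alt)
      case base
      show ?case by (simp add: cmat_simps)
    next
      case (step c X Z)
      then show ?case using S by (simp add: cmat_simps trace_add trace_cscale)
    qed
    then show "X = 0"
      using fixed_eq_0_if_compression_eq_0[OF r \<rho> v(1) R_def _ 0] by blast
  qed
  also have "card U \<le> card ((UNIV - {i}) \<times> (UNIV - {i} :: 'n set))"
    unfolding U_def by (intro card_image_le) simp
  also have "\<dots> = (CARD('n) - 1)\<^sup>2"
    by (simp add: card_cartesian_product card_Diff_singleton power2_eq_square)
  finally show ?thesis .
qed

text \<open>\<open>M\<close> has telescoping expectation along the orbit of the identity, so its expectation in the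
  definite limit \<open>\<rho>\<close> vanishes.\<close>

lemma dual_defect_eq_0:
  assumes r: "strict_mono r" and \<rho>: "(\<lambda>n. cesaro (r n) (mat 1)) \<longlonglongrightarrow> \<rho>" "positive_op \<rho>"
    and definite: "\<And>v. cinner v (\<rho> *v v) = 0 \<Longrightarrow> v = 0"
    and Z: "positive_op Z" and M: "positive_op M"
    and defect: "\<And>Y. trace (M ** Y) = trace (Z ** T Y) - trace (Z ** Y)"
  shows "M = 0"
proof -
  let ?d = "of_nat CARD('n) :: real"
  define a where "a k = trace (Z ** (T ^^ k) (mat 1))" for k
  obtain c where c: "positive_op (c *\<^sub>R mat 1 - Z)" "c > 0"
    using positive_op_le_multiple_of_1[OF Z] by blast
  \<comment> \<open>The expectations of \<open>Z\<close> stay bounded because \<open>Z\<close> lies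
    between 0 and \<open>c *\<^sub>R mat 1\<close> and the orbit of the identity has constant
    trace.\<close>
  have a: "cmod (a k) \<le> c * ?d" for k
  proof -
    let ?W = "(T ^^ k) (mat 1)"
    have W: "positive_op ?W" "trace ?W = of_real ?d"
      using channel.positive[OF funpow positive_op_mat_1] channel.trace_preserving[OF funpow]
      by (simp_all add: trace_I)
    have "a k \<in> \<real>\<^sub>\<ge>\<^sub>0" "trace ((c *\<^sub>R mat 1 - Z) ** ?W) \<in> \<real>\<^sub>\<ge>\<^sub>0"
      unfolding a_def by (intro trace_mult_positive Z W c)+
    then have "Re (a k) \<le> c * ?d" "a k \<in> \<real>\<^sub>\<ge>\<^sub>0"
      using W(2) by (simp_all add: a_def cmat_simps trace_sub trace_scaleR complex_nonneg_Reals_iff)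
    then show ?thesis by (simp add: nonneg_Reals_cmod_eq_Re)
  qed
  have eq: "trace (M ** cesaro n (mat 1)) = (a (Suc n) - a 0) / of_nat (Suc n)" for n
  proof -
    have "(\<Sum>k<Suc n. trace (M ** (T ^^ k) (mat 1))) = (\<Sum>k<Suc n. a (Suc k) - a k)"
      by (intro sum.cong refl) (simp add: defect a_def)
    also have "\<dots> = a (Suc n) - a 0" by (rule sum_lessThan_telescope)
    finally show ?thesis by (simp add: trace_mult_cesaro)
  qed
  have "(\<lambda>n. trace (M ** cesaro n (mat 1))) \<longlonglongrightarrow> 0"
  proof (rule Lim_null_comparison)
    have "cmod (trace (M ** cesaro n (mat 1))) \<le> 2 * c * ?d * inverse (real (Suc n))" for n
    proof -
      have "cmod (a (Suc n) - a 0) \<le> 2 * c * ?d"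
        using norm_triangle_ineq4[of "a (Suc n)" "a 0"] a[of "Suc n"] a[of 0] by linarith
      then have "cmod (a (Suc n) - a 0) * inverse (real (Suc n)) \<le> 2 * c * ?d * inverse (real (Suc n))"
        by (intro mult_right_mono) auto
      then show ?thesis
        by (simp only: eq norm_divide norm_of_nat) (simp only: divide_inverse)
    qed
    then show "\<forall>\<^sub>F n in sequentially. cmod (trace (M ** cesaro n (mat 1))) \<le> 2 * c * ?d * inverse (real (Suc n))"
      by simp
    show "(\<lambda>n. 2 * c * ?d * inverse (real (Suc n))) \<longlonglongrightarrow> 0"
      using tendsto_mult_right_zero[OF LIMSEQ_inverse_real_of_nat] by blast
  qed
  then have "(\<lambda>n. trace (M ** cesaro (r n) (mat 1))) \<longlonglongrightarrow> 0"
    using LIMSEQ_subseq_LIMSEQ[OF _ r] unfolding comp_def by fastforce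
  moreover have "(\<lambda>n. trace (M ** cesaro (r n) (mat 1))) \<longlonglongrightarrow> trace (M ** \<rho>)"
    by (intro bounded_linear.tendsto[OF bounded_linear_trace_mult] \<rho>)
  ultimately have M\<rho>: "trace (M ** \<rho>) = 0" using LIMSEQ_unique by blast
  obtain S where S: "cadj S = S" "S ** S = M"
    using positive_op_sqrt[OF M] by metis
  have pos: "positive_op (S ** \<rho> ** S)"
    using positive_op_conj[OF \<rho>(2), of S] S by simp
  have "trace (S ** \<rho> ** S) = trace (M ** \<rho>)"
    using S trace_mul_sym[of S "S ** \<rho>"] by (simp add: matrix_mul_assoc)
  \<comment> \<open>A positive operator of trace zero vanishes; definiteness of
    \<open>\<rho>\<close> then forces the range of the root \<open>S\<close> of \<open>M\<close> to
    be zero.\<close>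
  then have 0: "S ** \<rho> ** S = 0"
    using M\<rho> positive_op_trace_eq_0[OF pos] by simp
  have "S *v v = 0" for v
  proof (rule definite)
    have "cinner (S *v v) (\<rho> *v (S *v v)) = cinner v ((S ** \<rho> ** S) *v v)"
      using cinner_adjoint[of v S] S by (simp flip: matrix_vector_mul_assoc)
    then show "cinner (S *v v) (\<rho> *v (S *v v)) = 0"
      using 0 by (simp add: cinner_linear)
  qed
  then have "M *v v = 0" for v
    unfolding S(2)[symmetric] by (simp flip: matrix_vector_mul_assoc)
  then show ?thesis
    by (intro cmat_eqI) (simp add: cinner_linear)
qed

text \<open>By the dimension bound, a null vector of the limit \<open>\<rho>\<close> would leave too
  little room for the fixed points in \<open>S\<close>, so \<open>\<rho>\<close> is
  definite.\<close>

lemma dual_defect_eq_0_if_many_fixed: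
  assumes S: "\<And>X Y. X \<in> S \<Longrightarrow> trace (X ** T Y) = trace (X ** Y)"
    and dim: "(CARD('n) - 1)\<^sup>2 < cmat.dim (cmat.span S)"
    and Z: "positive_op Z" and M: "positive_op M"
    and defect: "\<And>Y. trace (M ** Y) = trace (Z ** T Y) - trace (Z ** Y)"
  shows "M = 0"
proof -
  obtain \<rho> r where r: "strict_mono r" "((\<lambda>n. cesaro n (mat 1)) \<circ> r) \<longlonglongrightarrow> \<rho>" "positive_op \<rho>"
    using bounded_positive_subseq[of "\<lambda>n. cesaro n (mat 1)" "trace (mat 1)"]
      channel.positive[OF channel_cesaro positive_op_mat_1]
      channel.trace_preserving[OF channel_cesaro] by metis
  then have lim: "(\<lambda>n. cesaro (r n) (mat 1)) \<longlonglongrightarrow> \<rho>" by (simp add: comp_def)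
  show ?thesis
  proof (rule dual_defect_eq_0[OF r(1) lim r(3) _ Z M defect])
    fix v assume "cinner v (\<rho> *v v) = 0"
    then show "v = 0"
      using dim_fixed_le_if_limit_degenerate[OF r(1) lim _ _ S] dim by fastforce
  qed
qed

end

section \<open>Complete positivity and the multiplicative domain\<close>

lemma sum_nonneg_Reals:
  fixes f :: "'a \<Rightarrow> complex"
  shows "(\<And>i. i \<in> I \<Longrightarrow> f i \<in> \<real>\<^sub>\<ge>\<^sub>0) \<Longrightarrow> sum f I \<in> \<real>\<^sub>\<ge>\<^sub>0"
  by (induction I rule: infinite_finite_induct) auto

lemma has_sum_nonneg_Reals:
  fixes f :: "'a \<Rightarrow> complex"
  assumes sum: "(f has_sum s) \<Omega>" and f: "\<And>x. x \<in> \<Omega> \<Longrightarrow> f x \<in> \<real>\<^sub>\<ge>\<^sub>0"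
  shows "s \<in> \<real>\<^sub>\<ge>\<^sub>0"
proof -
  have "((\<lambda>x. Re (f x)) has_sum Re s) \<Omega>"
    by (rule has_sum_bounded_linear[OF bounded_linear_Re sum])
  then have "0 \<le> Re s"
    by (rule has_sum_nonneg) (use f in \<open>auto simp: complex_nonneg_Reals_iff\<close>)
  have "((\<lambda>x. Im (f x)) has_sum Im s) \<Omega>"
    by (rule has_sum_bounded_linear[OF bounded_linear_Im sum])
  moreover have "((\<lambda>x. Im (f x)) has_sum 0) \<Omega>"
    by (rule has_sum_0) (use f in \<open>auto simp: complex_nonneg_Reals_iff\<close>)
  ultimately have "Im s = 0" by (rule has_sum_unique)
  with \<open>0 \<le> Re s\<close> show ?thesis by (simp add: complex_nonneg_Reals_iff)
qed

text \<open>Needed to pass equality in the Schwarz inequality from the total channel to each single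
  operation.\<close>

lemma has_sum_0_nonneg_RealsD:
  fixes f :: "'a \<Rightarrow> complex"
  assumes sum: "(f has_sum 0) \<Omega>" and f: "\<And>x. x \<in> \<Omega> \<Longrightarrow> f x \<in> \<real>\<^sub>\<ge>\<^sub>0" and x: "x \<in> \<Omega>"
  shows "f x = 0"
proof -
  have "((\<lambda>x. Re (f x)) has_sum 0) \<Omega>"
    using has_sum_bounded_linear[OF bounded_linear_Re sum] by simp
  then have "Re (f x) = 0"
    by (rule nonneg_has_sum_le_0D) (use f x in \<open>auto simp: complex_nonneg_Reals_iff\<close>)
  then show ?thesis using f[OF x] by (simp add: complex_nonneg_Reals_iff complex_eq_iff)
qed

section \<open>Completely positive maps and their duals\<close>

lemma completely_positive_imp_positive:
  assumes \<Phi>: "completely_positive \<Phi>" and Y: "positive_op Y"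
  shows "positive_op (\<Phi> Y)"
proof -
  have "positive_block 1 (\<lambda>i j. Y)"
    using Y by (simp add: positive_block_def positive_op_def)
  then have "positive_block 1 (\<lambda>i j. \<Phi> Y)"
    using \<Phi> by (simp add: completely_positive_def)
  then have "(\<Sum>i<(1::nat). \<Sum>j<(1::nat). cinner v (\<Phi> Y *v v)) \<in> \<real>\<^sub>\<ge>\<^sub>0" for v
    unfolding positive_block_def by (rule allE[of _ "\<lambda>i :: nat. v"])
  then show ?thesis by (simp add: positive_op_def)
qed

lemma trace_eq_sum_cinner: "trace M = (\<Sum>i\<in>UNIV. cinner (axis i 1) (M *v axis i 1))"
  unfolding trace_def by (rule sum.cong[OF refl matrix_entry_eq_cinner])

text \<open>In terms of the dual map \<open>F\<close> this is the quadratic form at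
  \<open>(v, w)\<close> of the block matrix with rows \<open>F (b ** b)\<close>, \<open>F b\<close>
  and \<open>F b\<close>, \<open>F (mat 1)\<close>; its positivity is the Schwarz inequality. It
  follows by applying the second ampliation to the rank-one block matrix built from \<open>v\<close>
  and \<open>w\<close>.\<close>

lemma completely_positive_two_block:
  fixes \<Phi> :: "'n::finite cmat \<Rightarrow> 'n cmat"
  assumes \<Phi>: "completely_positive \<Phi>" and b: "cadj b = b"
  shows "trace (b ** b ** \<Phi> (ketbra v v)) + trace (b ** \<Phi> (ketbra v w))
    + trace (b ** \<Phi> (ketbra w v)) + trace (\<Phi> (ketbra w w)) \<in> \<real>\<^sub>\<ge>\<^sub>0"
proof -
  define u where "u i = (if i = 0 then v else w)" for i :: nat
  have u: "u 0 = v" "u (Suc 0) = w" by (simp_all add: u_def)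
  have "positive_block 2 (\<lambda>i j. ketbra (u i) (u j))"
    unfolding positive_block_def
  proof
    fix s :: "nat \<Rightarrow> complex ^ 'n"
    let ?t = "\<Sum>j<2. cinner (u j) (s j)"
    have "(\<Sum>i<2. \<Sum>j<2. cinner (s i) (ketbra (u i) (u j) *v s j))
        = (\<Sum>i<2. \<Sum>j<2. cinner (s i) (u i) * cinner (u j) (s j))"
      by (simp add: ketbra_mult_vec cinner_linear mult.commute)
    also have "\<dots> = cnj ?t * ?t"
      by (simp add: sum_product cnj_cinner)
    also have "\<dots> \<in> \<real>\<^sub>\<ge>\<^sub>0"
      using complex_norm_square[of ?t]
      by (metis mult.commute nonneg_Reals_of_real_iff of_real_power zero_le_power2)
    finally show "(\<Sum>i<2. \<Sum>j<2. cinner (s i) (ketbra (u i) (u j) *v s j)) \<in> \<real>\<^sub>\<ge>\<^sub>0" .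
  qed
  then have block: "positive_block 2 (\<lambda>i j. \<Phi> (ketbra (u i) (u j)))"
    using \<Phi> by (simp add: completely_positive_def)
  have pos: "cinner s (\<Phi> (ketbra v v) *v s) + cinner s (\<Phi> (ketbra v w) *v t)
    + cinner t (\<Phi> (ketbra w v) *v s) + cinner t (\<Phi> (ketbra w w) *v t) \<in> \<real>\<^sub>\<ge>\<^sub>0" for s t
    using block[unfolded positive_block_def, rule_format, of "\<lambda>i. if i = 0 then s else t"]
    by (simp add: numeral_2_eq_2 u add.assoc)
  \<comment> \<open>Testing the positive block on the pairs \<open>(b *v e, e)\<close> and summing
    over the basis vectors \<open>e\<close> produces the four traces.\<close>
  have tr: "trace (b ** b ** \<Phi> (ketbra v v)) + trace (b ** \<Phi> (ketbra v w))
      + trace (b ** \<Phi> (ketbra w v)) + trace (\<Phi> (ketbra w w))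
    = (\<Sum>i\<in>UNIV. let e = axis i 1; s = b *v e in
        cinner s (\<Phi> (ketbra v v) *v s) + cinner s (\<Phi> (ketbra v w) *v e)
        + cinner e (\<Phi> (ketbra w v) *v s) + cinner e (\<Phi> (ketbra w w) *v e))"
  proof -
    have 1: "trace (b ** b ** \<Phi> (ketbra v v)) = trace (b ** (\<Phi> (ketbra v v) ** b))"
      using trace_mul_sym[of b "b ** \<Phi> (ketbra v v)"] by (simp only: matrix_mul_assoc)
    have 2: "trace (b ** \<Phi> (ketbra w v)) = trace (\<Phi> (ketbra w v) ** b)"
      by (rule trace_mul_sym)
    have 3: "cinner e (b *v z) = cinner (b *v e) z" for e z
      using cinner_adjoint[of e b z] b by simp
    show ?thesis
      unfolding 1 2 unfolding trace_eq_sum_cinner Let_def sum.distrib[symmetric]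
      by (simp only: matrix_vector_mul_assoc[symmetric] 3)
  qed
  show ?thesis
    unfolding tr Let_def by (rule sum_nonneg_Reals) (rule pos)
qed

lemma cinner_dual_map:
  assumes "clinear_map \<Phi>"
  shows "cinner v (dual_map \<Phi> X *v w) = trace (X ** \<Phi> (ketbra w v))"
  using dual_map_trace[OF assms, of X "ketbra w v"] by (simp only: trace_mult_ketbra)

lemma dual_map_positive:
  assumes "completely_positive \<Phi>" "positive_op X"
  shows "positive_op (dual_map \<Phi> X)"
proof -
  have lin: "clinear_map \<Phi>" using assms(1) by (simp add: completely_positive_def)
  have "trace (X ** \<Phi> (ketbra v v)) \<in> \<real>\<^sub>\<ge>\<^sub>0" for v
    by (rule trace_mult_positive[OF assms(2)
          completely_positive_imp_positive[OF assms(1) positive_op_ketbra]])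
  then show ?thesis
    by (simp add: positive_op_def cinner_dual_map[OF lin])
qed

text \<open>Equality in the Schwarz inequality for the dual map makes the \<open>2 \<times> 2\<close> block of
  \<open>completely_positive_two_block\<close> annihilate \<open>(v, - b v)\<close>.\<close>

lemma dual_map_multiplicative:
  fixes \<Phi> :: "'n::finite cmat \<Rightarrow> 'n cmat"
  assumes \<Phi>: "completely_positive \<Phi>" and b: "positive_op b"
    and eq: "\<And>v. let w = - (b *v v) in
      trace (b ** b ** \<Phi> (ketbra v v)) + trace (b ** \<Phi> (ketbra v w))
        + trace (b ** \<Phi> (ketbra w v)) + trace (\<Phi> (ketbra w w)) = 0"
  shows "dual_map \<Phi> b = dual_map \<Phi> (mat 1) ** b" "dual_map \<Phi> b = b ** dual_map \<Phi> (mat 1)"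
proof -
  let ?F = "dual_map \<Phi>"
  let ?a = "?F (mat 1)"
  have lin: "clinear_map \<Phi>" using \<Phi> by (simp add: completely_positive_def)
  have bh: "cadj b = b" using b by (rule positive_op_hermitian)
  have Fh: "cadj (?F b) = ?F b" by (intro positive_op_hermitian dual_map_positive \<Phi> b)
  have ah: "cadj ?a = ?a" by (intro positive_op_hermitian dual_map_positive \<Phi> positive_op_mat_1)
  define q where "q v w = cinner v (?F (b ** b) *v v) + cinner w (?F b *v v)
      + cinner v (?F b *v w) + cinner w (?a *v w)" for v w
  have q: "q v w = trace (b ** b ** \<Phi> (ketbra v v)) + trace (b ** \<Phi> (ketbra v w))
        + trace (b ** \<Phi> (ketbra w v)) + trace (\<Phi> (ketbra w w))" for v w
    unfolding q_def cinner_dual_map[OF lin] by simp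
  have q_nonneg: "q v w \<in> \<real>\<^sub>\<ge>\<^sub>0" for v w
    unfolding q by (rule completely_positive_two_block[OF \<Phi> bh])
  have q_0: "q v (- (b *v v)) = 0" for v
    using eq[of v] unfolding q Let_def .
  \<comment> \<open>With \<open>x = ?F b *v v\<close> and \<open>y = ?a *v ?w\<close> this is the
    first-order coefficient of the variation below.\<close>
  have sum_eq: "cinner (x + y) x + cinner x (x + y) + cinner y (x + y) + cinner (x + y) y
      = 2 * cinner (x + y) (x + y)" for x y :: "complex ^ 'n"
    by (simp add: cinner_linear)
  have "?F b *v v = (?a ** b) *v v" for v
  proof -
    let ?w = "- (b *v v)"
    \<comment> \<open>The second component of the block matrix applied to \<open>(v, ?w)\<close>.
      The form \<open>q\<close> is nonnegative and vanishes at \<open>(v, ?w)\<close>, so varying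
      \<open>?w\<close> in the direction \<open>?u\<close> forces \<open>?u = 0\<close>.\<close>
    let ?u = "?F b *v v + ?a *v ?w"
    have "0 \<le> t * (2 * Re (cinner ?u ?u)) + t\<^sup>2 * Re (cinner ?u (?a *v ?u))" for t :: real
    proof -
      have s: "M *v (t *\<^sub>R ?u) = t *\<^sub>R (M *v ?u)" for M :: "'n cmat"
        by (rule linear_scale) simp
      have 1: "cinner v (?F b *v ?u) = cinner (?F b *v v) ?u" "cinner ?w (?a *v ?u) = cinner (?a *v ?w) ?u"
        using cinner_adjoint[of v "?F b" ?u] cinner_adjoint[of ?w ?a ?u] Fh ah by simp_all
      have "q v (?w + t *\<^sub>R ?u) = q v ?w
          + of_real t * (cinner ?u (?F b *v v) + cinner v (?F b *v ?u)
            + cinner ?w (?a *v ?u) + cinner ?u (?a *v ?w))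
          + of_real (t\<^sup>2) * cinner ?u (?a *v ?u)"
        unfolding q_def matrix_vector_right_distrib[of _ ?w] s cinner_add_left[of ?w]
          cinner_add_right[of _ "_ *v ?w"] cinner_scaleR_left cinner_scaleR_right
        by (simp only: power2_eq_square of_real_mult algebra_simps)
      also have "cinner ?u (?F b *v v) + cinner v (?F b *v ?u)
            + cinner ?w (?a *v ?u) + cinner ?u (?a *v ?w) = 2 * cinner ?u ?u"
        unfolding 1 by (rule sum_eq)
      finally have "q v (?w + t *\<^sub>R ?u)
          = of_real (t * 2) * cinner ?u ?u + of_real (t\<^sup>2) * cinner ?u (?a *v ?u)"
        by (simp only: q_0 add_0_left of_real_mult of_real_numeral mult.assoc)
      then have "Re (q v (?w + t *\<^sub>R ?u)) = t * (2 * Re (cinner ?u ?u)) + t\<^sup>2 * Re (cinner ?u (?a *v ?u))"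
        by (simp only: plus_complex.sel Re_complex_of_real times_complex.sel Im_complex_of_real)
      then show ?thesis
        using q_nonneg[of v "?w + t *\<^sub>R ?u"] by (simp only: complex_nonneg_Reals_iff)
    qed
    then have "2 * Re (cinner ?u ?u) = 0" by (rule linear_coeff_eq_0)
    then have "?u = 0" by (simp only: cinner_self) simp
    moreover have "?a *v ?w = - ((?a ** b) *v v)"
      using matrix_vector_mult_diff_distrib[of ?a 0 "b *v v"] by (simp add: matrix_vector_mul_assoc)
    ultimately show ?thesis by (simp only: ) simp
  qed
  then show 1: "?F b = ?a ** b"
    by (simp add: matrix_eq)
  then have "cadj (?F b) = cadj (?a ** b)" by (rule arg_cong)
  then show "?F b = b ** ?a"
    by (simp only: Fh cadj_mult ah bh)
qed

section \<open>Instruments\<close>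

lemma has_sum_trace_total_channel:
  assumes "total_channel \<Omega> \<I> T"
  shows "((\<lambda>x. trace (X ** \<I> x Y)) has_sum trace (X ** T Y)) \<Omega>"
  using assms unfolding total_channel_def
  by (intro has_sum_bounded_linear[OF bounded_linear_trace_mult]) blast

lemma has_sum_trace_observable:
  assumes "observable \<Omega> A"
  shows "((\<lambda>x. trace (A x ** X)) has_sum trace X) \<Omega>"
proof -
  have "((\<lambda>x. trace (X ** A x)) has_sum trace (X ** mat 1)) \<Omega>"
    using assms unfolding observable_def
    by (intro has_sum_bounded_linear[OF bounded_linear_trace_mult]) blast
  then show ?thesis by (simp add: trace_mul_sym[of X])
qed

lemma total_channel_clinear:
  assumes lin: "\<And>x. x \<in> \<Omega> \<Longrightarrow> clinear_map (\<I> x)" and T: "total_channel \<Omega> \<I> T"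
  shows "clinear_map T"
proof (rule clinear_mapI)
  note tr = has_sum_trace_total_channel[OF T]
  have ext: "M = N" if "\<And>X. trace (X ** M) = trace (X ** N)" for M N :: "'b cmat"
    by (rule matrix_eq_if_trace_eq) (metis that trace_mul_sym)
  fix Y Z c
  show "T (Y + Z) = T Y + T Z"
  proof (rule ext)
    fix X
    have "((\<lambda>x. trace (X ** \<I> x (Y + Z))) has_sum trace (X ** T Y) + trace (X ** T Z)) \<Omega>"
      by (rule iffD1[OF has_sum_cong has_sum_add[OF tr tr]])
        (simp add: clinear_mapD[OF lin] cmat_simps trace_add)
    then show "trace (X ** T (Y + Z)) = trace (X ** (T Y + T Z))"
      using has_sum_unique[OF tr] by (simp add: cmat_simps trace_add)
  qed
  show "T (cscale c Y) = cscale c (T Y)"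
  proof (rule ext)
    fix X
    have "((\<lambda>x. trace (X ** \<I> x (cscale c Y))) has_sum c * trace (X ** T Y)) \<Omega>"
      by (rule iffD1[OF has_sum_cong has_sum_cmult_right[OF tr]])
        (simp add: clinear_mapD[OF lin] cmat_simps trace_cscale)
    then show "trace (X ** T (cscale c Y)) = trace (X ** cscale c (T Y))"
      using has_sum_unique[OF tr] by (simp add: cmat_simps trace_cscale)
  qed
qed

lemma channel_total_channel:
  assumes I: "instrument \<Omega> A \<I>" and T: "total_channel \<Omega> \<I> T" and A: "observable \<Omega> A"
  shows "channel T"
proof (rule channel.intro)
  have cp: "completely_positive (\<I> x)" "clinear_map (\<I> x)" "dual_map (\<I> x) (mat 1) = A x"
    if "x \<in> \<Omega>" for x
    using I that by (auto simp: instrument_def completely_positive_def)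
  show "clinear_map T"
    using cp(2) T by (rule total_channel_clinear)
  show "positive_op (T Y)" if Y: "positive_op Y" for Y
    unfolding positive_op_def
  proof
    fix v
    have "((\<lambda>x. cinner v (\<I> x Y *v v)) has_sum cinner v (T Y *v v)) \<Omega>"
      using T unfolding total_channel_def
      by (intro has_sum_bounded_linear[OF bounded_linear_quadratic_form]) blast
    then show "cinner v (T Y *v v) \<in> \<real>\<^sub>\<ge>\<^sub>0"
      by (rule has_sum_nonneg_Reals)
        (metis completely_positive_imp_positive cp(1) Y positive_op_def)
  qed
  show "trace (T Y) = trace Y" for Y
  proof -
    \<comment> \<open>Each operation has trace \<open>trace (A x ** Y)\<close> on \<open>Y\<close>,
      and the effects sum to the identity.\<close>
    have "trace (mat 1 ** \<I> x Y) = trace (A x ** Y)" if "x \<in> \<Omega>" for x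
      using dual_map_trace[OF cp(2)[OF that], of "mat 1" Y] cp(3)[OF that] by simp
    then have "((\<lambda>x. trace (mat 1 ** \<I> x Y)) has_sum trace Y) \<Omega>"
      by (rule iffD2[OF has_sum_cong has_sum_trace_observable[OF A]])
    then show ?thesis
      using has_sum_unique[OF has_sum_trace_total_channel[OF T, of "mat 1" Y]] by simp
  qed
qed

section \<open>Non-disturbance implies commutation\<close>

lemma commuting_if_measurable_without_disturbing:
  fixes A :: "'x \<Rightarrow> 'n::finite cmat" and B :: "'y \<Rightarrow> 'n cmat"
  assumes B: "observable \<Omega>B B" and dim: "obs_dim \<Omega>B B \<ge> (CARD('n) - 1)\<^sup>2 + 1"
    and A: "observable \<Omega>A A" and meas: "measurable_without_disturbing \<Omega>A A \<Omega>B B"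
  shows "commuting \<Omega>A A \<Omega>B B"
proof -
  obtain \<I> T where I: "instrument \<Omega>A A \<I>" and T: "total_channel \<Omega>A \<I> T"
    and fixed: "\<And>y. y \<in> \<Omega>B \<Longrightarrow> dual_map T (B y) = B y"
    using meas unfolding measurable_without_disturbing_def by blast
  interpret channel T using I T A by (rule channel_total_channel)
  have tr_fixed: "trace (X ** T Y) = trace (X ** Y)" if "X \<in> B ` \<Omega>B" for X Y
    using that fixed dual_map_trace[OF clinear, of X Y] by auto
  have dim': "(CARD('n) - 1)\<^sup>2 < cmat.dim (cmat.span (B ` \<Omega>B))"
    using dim by (simp add: obs_dim_def)
  have "A x ** B y = B y ** A x" if x: "x \<in> \<Omega>A" and y: "y \<in> \<Omega>B" for x y
  proof -
    define b where "b = B y"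
    have b: "positive_op b" using B y by (auto simp: observable_def b_def)
    have bh: "cadj b = b" using b by (rule positive_op_hermitian)
    have Z: "positive_op (b ** b)"
      using positive_op_conj[OF positive_op_mat_1, of b] bh by simp
    \<comment> \<open>The Schwarz form of \<open>completely_positive_two_block\<close>. It is
      additive in the map, so the form of \<open>T\<close> is the sum of those of the
      operations.\<close>
    define q where "q \<Phi> v w = trace (b ** b ** \<Phi> (ketbra v v)) + trace (b ** \<Phi> (ketbra v w))
      + trace (b ** \<Phi> (ketbra w v)) + trace (\<Phi> (ketbra w w))" for \<Phi> and v w :: "complex ^ 'n"
    have cp: "completely_positive (\<I> x)" if "x \<in> \<Omega>A" for x
      using I that by (auto simp: instrument_def)
    have q_nonneg: "q (\<I> x) v w \<in> \<real>\<^sub>\<ge>\<^sub>0" if "x \<in> \<Omega>A" for x v w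
      unfolding q_def by (rule completely_positive_two_block[OF cp[OF that] bh])
    have q_sum: "((\<lambda>x. q (\<I> x) v w) has_sum q T v w) \<Omega>A" for v w
      unfolding q_def
      using has_sum_trace_total_channel[OF T, of "mat 1" "ketbra w w"]
      by (intro has_sum_add has_sum_trace_total_channel[OF T]) simp
    define M where "M = dual_map T (b ** b) - b ** b"
    \<comment> \<open>At \<open>w = - (b *v v)\<close> the dual map of \<open>T\<close> fixes
      \<open>b\<close> and the identity, so the last three terms add up to minus the squared norm of
      \<open>b *v v\<close> and the Schwarz defect remains.\<close>
    have qM: "q T v (- (b *v v)) = cinner v (M *v v)" for v
    proof -
      have tb: "trace (b ** T Y) = trace (b ** Y)" for Y
        using tr_fixed[of b Y] y by (simp add: b_def)
      have mb: "b *v (- u) = - (b *v u)" for u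
        using matrix_vector_mult_diff_distrib[of b 0 u] by simp
      have bb: "cinner v (b *v (b *v v)) = cinner (b *v v) (b *v v)"
        using cinner_adjoint[of v b "b *v v"] bh by simp
      show ?thesis
        unfolding q_def tb trace_preserving M_def matrix_vector_mult_diff_rdistrib
          cinner_diff_right cinner_dual_map[OF clinear]
        by (simp add: trace_mult_ketbra trace_ketbra cinner_linear mb bb
            flip: matrix_vector_mul_assoc)
    qed
    have "positive_op M"
      unfolding positive_op_def qM[symmetric]
      using has_sum_nonneg_Reals[OF q_sum q_nonneg] by blast
    moreover have "trace (M ** Y) = trace (b ** b ** T Y) - trace (b ** b ** Y)" for Y
      using dual_map_trace[OF clinear, of "b ** b" Y] by (simp add: M_def cmat_simps trace_sub)
    ultimately have "M = 0"
      using dual_defect_eq_0_if_many_fixed[OF tr_fixed dim' Z] by blast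
    then have "((\<lambda>x. q (\<I> x) v (- (b *v v))) has_sum 0) \<Omega>A" for v
      using q_sum[of v "- (b *v v)"] by (simp add: qM cinner_linear)
    \<comment> \<open>The nonnegative forms of the operations sum to zero, so each one attains
      equality and the multiplicative domain argument applies to \<open>\<I> x\<close>.\<close>
    then have "q (\<I> x) v (- (b *v v)) = 0" for v
      by (rule has_sum_0_nonneg_RealsD[where f = "\<lambda>x. q (\<I> x) v (- (b *v v))"])
        (auto intro: q_nonneg x)
    then have "dual_map (\<I> x) b = dual_map (\<I> x) (mat 1) ** b"
      "dual_map (\<I> x) b = b ** dual_map (\<I> x) (mat 1)"
      by (intro dual_map_multiplicative[OF cp[OF x] b]; simp only: q_def Let_def)+
    moreover have "dual_map (\<I> x) (mat 1) = A x"
      using I x by (auto simp: instrument_def)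
    ultimately show ?thesis unfolding b_def by metis
  qed
  then show ?thesis unfolding commuting_def by blast
qed

section \<open>The Lueders instrument\<close>

lemma completely_positive_conj:
  fixes S :: "'n::finite cmat"
  assumes "cadj S = S"
  shows "completely_positive (\<lambda>Y. S ** Y ** S)"
  unfolding completely_positive_def
proof (intro conjI allI impI)
  show "clinear_map (\<lambda>Y. S ** Y ** S)" by (rule clinear_map_conj)
  fix k and X :: "nat \<Rightarrow> nat \<Rightarrow> 'n cmat"
  assume X: "positive_block k X"
  have S: "cinner v (S *v w) = cinner (S *v v) w" for v w
    using cinner_adjoint[of v S w] assms by simp
  show "positive_block k (\<lambda>i j. S ** X i j ** S)"
    unfolding positive_block_def matrix_vector_mul_assoc[symmetric] S
    using X[unfolded positive_block_def, rule_format, of "\<lambda>i. S *v _ i"] by blast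
qed

lemma dual_map_conj: "dual_map (\<lambda>Y. S ** Y ** S) = (\<lambda>X. S ** X ** S)"
proof (rule dual_map_unique)
  fix X Y :: "'a cmat"
  show "trace (X ** (S ** Y ** S)) = trace (S ** X ** S ** Y)"
    using trace_mul_sym[of "X ** S ** Y" S] by (simp add: matrix_mul_assoc)
qed

lemma measurable_without_disturbing_if_commuting:
  fixes A :: "'x \<Rightarrow> 'n::finite cmat" and B :: "'y \<Rightarrow> 'n cmat"
  assumes A: "observable \<Omega>A A" and comm: "commuting \<Omega>A A \<Omega>B B"
  shows "measurable_without_disturbing \<Omega>A A \<Omega>B B"
proof -
  have "\<exists>S. cadj S = S \<and> S ** S = A x \<and> (\<forall>C. C ** A x = A x ** C \<longrightarrow> C ** S = S ** C)"
    if "x \<in> \<Omega>A" for x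
  proof -
    have "positive_op (A x)" using A that by (simp add: observable_def)
    then show ?thesis using positive_op_sqrt by metis
  qed
  then obtain S where S: "\<And>x. x \<in> \<Omega>A \<Longrightarrow> cadj (S x) = S x" "\<And>x. x \<in> \<Omega>A \<Longrightarrow> S x ** S x = A x"
    and SC: "\<And>x C. x \<in> \<Omega>A \<Longrightarrow> C ** A x = A x ** C \<Longrightarrow> C ** S x = S x ** C"
    by metis
  define \<I> where "\<I> x Y = S x ** Y ** S x" for x Y
  have I_eq: "\<I> x = (\<lambda>Y. S x ** Y ** S x)" for x
    by (simp add: \<I>_def fun_eq_iff)
  have I_lin: "clinear_map (\<I> x)" for x
    unfolding I_eq by (rule clinear_map_conj)
  have I: "instrument \<Omega>A A \<I>"
    unfolding instrument_def I_eq dual_map_conj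
    by (auto simp: S intro!: completely_positive_conj)
  \<comment> \<open>Absolute convergence: the norm of each term is at most a constant times the
    trace of \<open>A x\<close>, and these traces sum to the dimension.\<close>
  have "(\<lambda>x. \<I> x Y) summable_on \<Omega>A" for Y
  proof -
    have "bounded_linear ((*v) Y)"
      by (simp add: linear_conv_bounded_linear[symmetric])
    then obtain K where K: "K > 0" "\<And>v. norm (Y *v v) \<le> norm v * K"
      using bounded_linear.pos_bounded by blast
    let ?c = "of_nat (CARD('n) ^ 3) * K"
    have "((\<lambda>x. trace (A x)) has_sum trace (mat 1 :: 'n cmat)) \<Omega>A"
      using has_sum_trace_observable[OF A, of "mat 1"] by simp
    then have "((\<lambda>x. Re (trace (A x))) has_sum Re (trace (mat 1 :: 'n cmat))) \<Omega>A"
      by (rule has_sum_bounded_linear[OF bounded_linear_Re])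
    then have "(\<lambda>x. ?c * Re (trace (A x))) summable_on \<Omega>A"
      by (intro summable_on_cmult_right) (rule has_sum_imp_summable)
    moreover have "norm (\<I> x Y) \<le> ?c * Re (trace (A x))" if "x \<in> \<Omega>A" for x
      using norm_sandwich_le[OF S(1)[OF that] _ K(2)] K(1) S(2)[OF that] by (simp add: \<I>_def)
    ultimately have "(\<lambda>x. norm (\<I> x Y)) summable_on \<Omega>A"
      by (rule Infinite_Sum.abs_summable_on_comparison_test')
    then show ?thesis by (rule abs_summable_summable)
  qed
  then have T: "total_channel \<Omega>A \<I> (\<lambda>Y. \<Sum>\<^sub>\<infinity>x\<in>\<Omega>A. \<I> x Y)" (is "total_channel _ _ ?T")
    by (simp add: total_channel_def)
  have lin: "clinear_map ?T"
    by (rule total_channel_clinear[OF _ T]) (simp add: I_lin)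
  have "dual_map ?T (B y) = B y" if y: "y \<in> \<Omega>B" for y
  proof (rule matrix_eq_if_trace_eq)
    fix Y
    have eq: "trace (B y ** \<I> x Y) = trace (A x ** (B y ** Y))" if x: "x \<in> \<Omega>A" for x
    proof -
      \<comment> \<open>The root commutes with everything that commutes with \<open>A x\<close>;
        moving \<open>B y\<close> past one root lets the two roots recombine to \<open>A x\<close>
        under the trace.\<close>
      have BS: "B y ** S x = S x ** B y"
      proof (rule SC[OF x])
        show "B y ** A x = A x ** B y"
          using comm x y unfolding commuting_def by metis
      qed
      have "trace (B y ** \<I> x Y) = trace (S x ** (B y ** S x) ** Y)"
        unfolding \<I>_def using trace_mul_sym[of "B y ** S x ** Y" "S x"]
        by (simp only: matrix_mul_assoc)
      also have "\<dots> = trace (A x ** (B y ** Y))"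
        unfolding BS by (simp only: matrix_mul_assoc S(2)[OF x])
      finally show ?thesis .
    qed
    have "((\<lambda>x. trace (B y ** \<I> x Y)) has_sum trace (B y ** Y)) \<Omega>A"
      by (rule iffD2[OF has_sum_cong has_sum_trace_observable[OF A]]) (rule eq)
    then have "trace (B y ** ?T Y) = trace (B y ** Y)"
      using has_sum_unique has_sum_trace_total_channel[OF T] by blast
    then show "trace (dual_map ?T (B y) ** Y) = trace (B y ** Y)"
      using dual_map_trace[OF lin] by metis
  qed
  then show ?thesis
    unfolding measurable_without_disturbing_def using I T by blast
qed

theorem proposition5:
  fixes \<Omega>A :: "'x set" and A :: "'x \<Rightarrow> complex ^ 'n::finite ^ 'n"
    and \<Omega>B :: "'y set" and B :: "'y \<Rightarrow> complex ^ 'n ^ 'n"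
  assumes "observable \<Omega>B B"
    and "obs_dim \<Omega>B B \<ge> (CARD('n) - 1)\<^sup>2 + 1"
    and "observable \<Omega>A A"
  shows "measurable_without_disturbing \<Omega>A A \<Omega>B B \<longleftrightarrow> commuting \<Omega>A A \<Omega>B B"
  using commuting_if_measurable_without_disturbing[OF assms]
    measurable_without_disturbing_if_commuting[OF assms(3)] by blast

end
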